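(* Let $G$ be a graph on $\{1,\dots,n\}$ with complement $\bar G$, and let $\mathcal{D}=\{w\in\mathbb{R}^n_{\ge0}:\sum_iw_i=1\}$. Then $$\frac{1}{\alpha^*(\bar G)}\le \min_{w\in\mathcal{D}}\beta(G,w)\le\frac{1}{\vartheta(\bar G)},$$ and the lower bound is attained (equality) whenever $G$ is $\hbar$-perfect. Equivalently, for any set of Pauli strings $\{S_1,\dots,S_n\}$ with frustration graph $G$, the quantity $\delta(\{S_i\})=\min_{w\in\mathcal{D}}\max_{|\psi\rangle}\sum_iw_i\langle\psi|S_i|\psi\rangle^2$ lies in $[1/\alpha^*(\bar G),1/\vartheta(\bar G)]$, with $\delta=1/\alpha^*(\bar G)$ when $G$ is $\hbar$-perfect.
   Context: For a graph $H$ on $\{1,\dots,n\}$, the fractional packing number is $\alpha^*(H)=\max\{\sum_iw_i: w\ge0,\ \sum_{i\in K}w_i\le1 \text{ for every clique }K\text{ of }H\}$ (so $\alpha^*(\bar G)$ has constraints over independent sets of $G$). $\vartheta(H)$ is the Lovász theta number, $\vartheta(H)=\max\{\operatorname{tr}(BJ): B\succeq0,\ \operatorname{tr}B=1,\ B_{ij}=0 \text{ for every edge } ij \text{ of } H\}$, $J$ the all-ones matrix. The frustration graph of Pauli strings (tensor products of matrices from $\{I,X,Y,Z\}$) $S_1,\dots,S_n$ has edge $ij$ iff $S_i,S_j$ anticommute; such a tuple is a realization of $G$, and every graph has one. $\beta(G,w)=\sup_\rho\sum_iw_i\operatorname{tr}(\rho S_i)^2$ over density matrices (independent of realization); $\alpha(G,w)=\max\{\sum_{i\in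 I}w_i:I\text{ independent}\}$; $G$ is $\hbar$-perfect if $\beta(G,w)=\alpha(G,w)$ for all $w\ge0$. *)

theory Defs
  imports Complex_Main "Jordan_Normal_Form.Matrix"
begin

definition mat_trace :: "'a::comm_monoid_add mat \<Rightarrow> 'a" where
  "mat_trace A = (\<Sum>i<dim_row A. A $$ (i,i))"

text \<open>A graph on n vertices is given by an adjacency relation E; only its values on
  {0..<n} matter. Vertices are numbered 0..n-1 instead of 1..n.\<close>

definition compl_graph :: "(nat \<Rightarrow> nat \<Rightarrow> bool) \<Rightarrow> nat \<Rightarrow> nat \<Rightarrow> bool" where
  "compl_graph E i j \<longleftrightarrow> i \<noteq> j \<and> \<not> E i j"

definition is_clique :: "(nat \<Rightarrow> nat \<Rightarrow> bool) \<Rightarrow> nat \<Rightarrow> nat set \<Rightarrow> bool" where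
  "is_clique H n K \<longleftrightarrow> K \<subseteq> {0..<n} \<and> (\<forall>i\<in>K. \<forall>j\<in>K. i \<noteq> j \<longrightarrow> H i j)"

definition is_indep :: "(nat \<Rightarrow> nat \<Rightarrow> bool) \<Rightarrow> nat \<Rightarrow> nat set \<Rightarrow> bool" where
  "is_indep G n I \<longleftrightarrow> I \<subseteq> {0..<n} \<and> (\<forall>i\<in>I. \<forall>j\<in>I. i \<noteq> j \<longrightarrow> \<not> G i j)"

definition alpha_w :: "(nat \<Rightarrow> nat \<Rightarrow> bool) \<Rightarrow> nat \<Rightarrow> (nat \<Rightarrow> real) \<Rightarrow> real" where
  "alpha_w G n w = Max ((\<lambda>I. \<Sum>i\<in>I. w i) ` {I. is_indep G n I})"

definition frac_packing :: "(nat \<Rightarrow> nat \<Rightarrow> bool) \<Rightarrow> nat \<Rightarrow> real" where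
  "frac_packing H n = Sup {(\<Sum>i<n. w i) | w :: nat \<Rightarrow> real.
      (\<forall>i<n. 0 \<le> w i) \<and> (\<forall>K. is_clique H n K \<longrightarrow> (\<Sum>i\<in>K. w i) \<le> 1)}"

definition psd_real :: "nat \<Rightarrow> real mat \<Rightarrow> bool" where
  "psd_real d B \<longleftrightarrow> B \<in> carrier_mat d d \<and> (\<forall>i<d. \<forall>j<d. B $$ (i,j) = B $$ (j,i)) \<and>
     (\<forall>x :: nat \<Rightarrow> real. 0 \<le> (\<Sum>i<d. \<Sum>j<d. x i * B $$ (i,j) * x j))"

definition lovasz_theta :: "(nat \<Rightarrow> nat \<Rightarrow> bool) \<Rightarrow> nat \<Rightarrow> real" where
  "lovasz_theta H n = Sup {(\<Sum>i<n. \<Sum>j<n. B $$ (i,j)) | B.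
      psd_real n B \<and> mat_trace B = 1 \<and> (\<forall>i<n. \<forall>j<n. i \<noteq> j \<longrightarrow> H i j \<longrightarrow> B $$ (i,j) = 0)}"

definition pauli1 :: "nat \<Rightarrow> complex mat" where
  "pauli1 a = (if a = 1 then mat_of_rows_list 2 [[0, 1], [1, 0]]
     else if a = 2 then mat_of_rows_list 2 [[0, -\<i>], [\<i>, 0]]
     else if a = 3 then mat_of_rows_list 2 [[1, 0], [0, -1]]
     else mat_of_rows_list 2 [[1, 0], [0, 1]])"

text \<open>Tensor product P_{p 0} (x) ... (x) P_{p (q-1)} on q qubits, written entrywise:
  the (i,j) entry of a Kronecker product is the product of the entries indexed by the
  binary digits of i and j.\<close>
definition pauli_string :: "nat \<Rightarrow> (nat \<Rightarrow> nat) \<Rightarrow> complex mat" where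
  "pauli_string q p = mat (2^q) (2^q)
     (\<lambda>(i,j). \<Prod>k<q. pauli1 (p k) $$ ((i div 2^k) mod 2, (j div 2^k) mod 2))"

definition is_pauli_string :: "nat \<Rightarrow> complex mat \<Rightarrow> bool" where
  "is_pauli_string q S \<longleftrightarrow> (\<exists>p. (\<forall>k<q. p k < 4) \<and> S = pauli_string q p)"

definition realization :: "nat \<Rightarrow> nat \<Rightarrow> (nat \<Rightarrow> complex mat) \<Rightarrow> (nat \<Rightarrow> nat \<Rightarrow> bool) \<Rightarrow> bool" where
  "realization q n S G \<longleftrightarrow> (\<forall>i<n. is_pauli_string q (S i)) \<and>
     (\<forall>i<n. \<forall>j<n. G i j \<longleftrightarrow> S i * S j = - (S j * S i))"

definition density_matrix :: "nat \<Rightarrow> complex mat \<Rightarrow> bool" where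
  "density_matrix d \<rho> \<longleftrightarrow> \<rho> \<in> carrier_mat d d \<and>
     (\<forall>i<d. \<forall>j<d. \<rho> $$ (i,j) = cnj (\<rho> $$ (j,i))) \<and>
     (\<forall>v :: nat \<Rightarrow> complex. 0 \<le> Re (\<Sum>i<d. \<Sum>j<d. cnj (v i) * \<rho> $$ (i,j) * v j)) \<and>
     mat_trace \<rho> = 1"

text \<open>beta(G,w) computed with the realization S (tr(rho S_i) is real since both are Hermitian).\<close>
definition beta_S :: "nat \<Rightarrow> nat \<Rightarrow> (nat \<Rightarrow> complex mat) \<Rightarrow> (nat \<Rightarrow> real) \<Rightarrow> real" where
  "beta_S q n S w = Sup {(\<Sum>i<n. w i * (Re (mat_trace (\<rho> * S i)))^2) | \<rho>. density_matrix (2^q) \<rho>}"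

text \<open>hbar-perfectness: beta(G,w) = alpha(G,w) for all w >= 0, with beta computed in any
  realization (beta is independent of the realization).\<close>
definition hbar_perfect :: "(nat \<Rightarrow> nat \<Rightarrow> bool) \<Rightarrow> nat \<Rightarrow> bool" where
  "hbar_perfect G n \<longleftrightarrow> (\<forall>q S. realization q n S G \<longrightarrow>
     (\<forall>w. (\<forall>i<n. 0 \<le> w i) \<longrightarrow> beta_S q n S w = alpha_w G n w))"

definition simplex :: "nat \<Rightarrow> (nat \<Rightarrow> real) set" where
  "simplex n = {w. (\<forall>i<n. 0 \<le> w i) \<and> (\<Sum>i<n. w i) = 1}"

end

theory Submission
  imports Defs
begin

text \<open>
  Lower bound: commuting Pauli strings have a joint eigenvector with eigenvalues 1 and -1, so
  beta(G,w) is at least the weight of every independent set; dividing w by beta(G,w) therefore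
  gives a fractional packing of the complement. If beta = alpha, the same rescaling turns every
  packing into a point of the simplex whose beta is at most the reciprocal of its total weight.

  Upper bound: let B be feasible for theta of the complement and let z collect the squared
  expectations of a state. The moment matrix of the state vanishes on the edges of G and B
  vanishes off them, so the Schur product theorem bounds the quadratic form of B at z by the
  inner product of z with diag(B). If B is optimal, then B 1 = theta diag(B), and Cauchy-Schwarz
  in the form B bounds this inner product by 1/theta, so diag(B) is a good weight vector.
\<close>

section \<open>Positive semidefinite forms\<close>

text \<open>The link between a state and the theta constraint is the identity z^T B z = x^T (B o x
  x^T) x, where x holds the expectations, z their squares, and o is the entrywise product. Variances
  are nonnegative, so x x^T lies below the real moment matrix M as a quadratic form, and B o M is
  diagonal; this turns z^T B z into a bound by s, the inner product of z with diag(B). The relation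
  B 1 = \<theta> diag(B) comes from varying c in diag(c) B diag(c): optimality of \<theta> makes
  \<theta> diag(B) - B positive semidefinite, and at an optimal B its form vanishes at the all-ones
  vector. Then \<theta> s = 1^T B z, hence (\<theta> s)^2 \<le> \<theta> s, that is s \<le>
  1/\<theta>. The weights are explicit, so no minimax duality enters. Attainment of the minimum over
  the simplex is part of the claim and needs a separate compactness argument. All bounds are proved
  in an arbitrary fixed realization.\<close>

definition bil :: "nat \<Rightarrow> (nat \<Rightarrow> nat \<Rightarrow> real) \<Rightarrow> (nat \<Rightarrow> real) \<Rightarrow> (nat \<Rightarrow> real) \<Rightarrow> real" where
  "bil n F x y = (\<Sum>i<n. \<Sum>j<n. x i * F i j * y j)"

text \<open>Kernels are functions rather than matrices: the leading n by n block of a larger kernel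
  is then the same function with a smaller bound, and rescalings and differences are
  pointwise.\<close>

definition psd_form :: "nat \<Rightarrow> (nat \<Rightarrow> nat \<Rightarrow> real) \<Rightarrow> bool" where
  "psd_form n F \<longleftrightarrow> (\<forall>i<n. \<forall>j<n. F i j = F j i) \<and> (\<forall>x. 0 \<le> bil n F x x)"

lemma bil_lincomb:
  assumes "\<And>i j. i < n \<Longrightarrow> j < n \<Longrightarrow> F i j = F j i"
  shows "bil n F (\<lambda>i. l * x i + m * y i) (\<lambda>i. l * x i + m * y i) =
         l^2 * bil n F x x + 2 * l * m * bil n F x y + m^2 * bil n F y y"
proof -
  have sym: "bil n F y x = bil n F x y"
    unfolding bil_def
    by (subst sum.swap) (intro sum.cong refl, simp add: assms mult.commute mult.left_commute)
  have "bil n F (\<lambda>i. l * x i + m * y i) (\<lambda>i. l * x i + m * y i) =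
        l^2 * bil n F x x + l * m * bil n F x y + l * m * bil n F y x + m^2 * bil n F y y"
    unfolding bil_def sum_distrib_left sum.distrib[symmetric]
    by (intro sum.cong refl) (simp add: algebra_simps power2_eq_square)
  then show ?thesis by (simp add: sym)
qed

text \<open>The form is nonnegative on the plane spanned by x and y, so the discriminant of the
  resulting quadratic in l and m has a sign. The degenerate case c = 0 needs its own
  argument.\<close>

lemma psd_form_Cauchy_Schwarz:
  assumes "psd_form n F"
  shows "(bil n F x y)^2 \<le> bil n F x x * bil n F y y"
proof -
  define a b c where abc: "a = bil n F x x" "b = bil n F x y" "c = bil n F y y"
  have q: "0 \<le> l^2 * a + 2 * l * m * b + m^2 * c" for l m
  proof -
    have "\<And>i j. i < n \<Longrightarrow> j < n \<Longrightarrow> F i j = F j i" using assms unfolding psd_form_def by blast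
    then have "l^2 * a + 2 * l * m * b + m^2 * c = bil n F (\<lambda>i. l * x i + m * y i) (\<lambda>i. l * x i + m * y i)"
      unfolding abc by (rule bil_lincomb[symmetric])
    then show ?thesis using assms unfolding psd_form_def by simp
  qed
  have c0: "0 \<le> c" using q[of 0 1] by simp
  show ?thesis
  proof (cases "c = 0")
    case True
    have "b = 0"
    proof (rule ccontr)
      assume "b \<noteq> 0"
      \<comment> \<open>With c = 0 the quadratic is linear in m, and this m brings it down to a - (a
        + 1) = -1.\<close>
      then show False using q[of 1 "-(a+1)/(2*b)"] True by (simp add: field_simps)
    qed
    then show ?thesis using True by (simp add: abc)
  next
    case False
    with c0 have "c > 0" by simp
    moreover have "0 \<le> c * (a * c - b^2)"
      using q[of c "-b"] by (simp add: algebra_simps power2_eq_square)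
    ultimately have "0 \<le> a * c - b^2" by (simp add: zero_le_mult_iff)
    then show ?thesis by (simp add: abc)
  qed
qed

lemma bil_Suc:
  assumes "\<And>i j. i < Suc n \<Longrightarrow> j < Suc n \<Longrightarrow> F i j = F j i"
  shows "bil (Suc n) F x x = bil n F x x + 2 * x n * (\<Sum>i<n. F n i * x i) + (x n)^2 * F n n"
proof -
  have "(\<Sum>i<n. x i * F i n * x n) = x n * (\<Sum>i<n. F n i * x i)"
    unfolding sum_distrib_left by (intro sum.cong refl) (simp add: assms)
  moreover have "(\<Sum>i<n. x n * F n i * x i) = x n * (\<Sum>i<n. F n i * x i)"
    unfolding sum_distrib_left by (intro sum.cong refl) (simp add: assms)
  ultimately show ?thesis
    unfolding bil_def by (simp add: sum.distrib algebra_simps power2_eq_square)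
qed

lemma bil_rank_one: "bil n (\<lambda>i j. h i * h j * c) x x = c * (\<Sum>i<n. h i * x i)^2"
  unfolding bil_def power2_eq_square sum_product
  by (simp add: sum_distrib_left mult_ac)

lemma bil_minus: "bil n (\<lambda>i j. F i j - H i j) x y = bil n F x y - bil n H x y"
  unfolding bil_def by (simp add: sum_subtractf algebra_simps)

text \<open>Cholesky factorisation by induction on the size: split off the rank-one kernel built
  from the last row, then factor the Schur complement. It stands in for the spectral theorem in the
  Schur product argument.\<close>

lemma psd_form_Gram:
  assumes "psd_form n F"
  shows "\<exists>L. \<forall>i<n. \<forall>j<n. F i j = (\<Sum>k<n. L k i * L k j)"
  using assms
proof (induction n arbitrary: F)
  case 0
  then show ?case by simp
next
  case (Suc n)
  have sym: "F i j = F j i" if "i < Suc n" "j < Suc n" for i j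
    using Suc.prems that unfolding psd_form_def by blast
  have pos: "0 \<le> bil n F x x + 2 * t * (\<Sum>i<n. F n i * x i) + t^2 * F n n" for x t
  proof -
    have "bil n F (x(n := t)) (x(n := t)) = bil n F x x"
      unfolding bil_def by (intro sum.cong refl) simp
    moreover have "(\<Sum>i<n. F n i * (x(n := t)) i) = (\<Sum>i<n. F n i * x i)"
      by (intro sum.cong refl) simp
    moreover have "0 \<le> bil (Suc n) F (x(n := t)) (x(n := t))"
      using Suc.prems unfolding psd_form_def by blast
    moreover have "bil (Suc n) F (x(n := t)) (x(n := t)) = bil n F (x(n := t)) (x(n := t)) +
        2 * (x(n := t)) n * (\<Sum>i<n. F n i * (x(n := t)) i) + ((x(n := t)) n)^2 * F n n"
      by (rule bil_Suc) (rule sym)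
    ultimately show ?thesis by simp
  qed
  define b where "b = F n n"
  have b0: "0 \<le> b" using pos[of "\<lambda>_. 0" 1] by (simp add: b_def bil_def)
  \<comment> \<open>When the pivot vanishes, so does its row, and division by 0 makes the Schur complement F itself.\<close>
  have row0: "F n i = 0" if "b = 0" "i < n" for i
  proof (rule ccontr)
    assume ne: "F n i \<noteq> 0"
    define e where "e = (\<lambda>j. if j = i then 1 else 0 :: real)"
    have "(\<Sum>j<n. F n j * e j) = F n i"
      using that by (simp add: e_def if_distrib[of "\<lambda>u. _ * u"] cong: if_cong)
    \<comment> \<open>The last coordinate is chosen so that the form, linear in it for b = 0, takes
      the value -1.\<close>
    then show False
      using pos[of e "- (bil n F e e + 1) / (2 * F n i)"] ne that by (simp add: b_def field_simps)
  qed
  define F' where "F' = (\<lambda>i j. F i j - F n i * F n j * (1 / b))"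
  have "psd_form n F'"
    unfolding psd_form_def
  proof (intro conjI allI impI)
    show "F' i j = F' j i" if "i < n" "j < n" for i j
      using that sym by (simp add: F'_def mult.commute)
    show "0 \<le> bil n F' x x" for x
    proof -
      define y where "y = (\<Sum>i<n. F n i * x i)"
      have e: "bil n F' x x = bil n F x x - 1 / b * y^2"
        unfolding F'_def y_def bil_minus bil_rank_one ..
      show ?thesis
      proof (cases "b = 0")
        case True
        then show ?thesis using e pos[of x 0] by simp
      next
        case False
        \<comment> \<open>Completing the square: t = - y / b minimises the form over the last
          coordinate, and the minimum is the Schur complement.\<close>
        then have "2 * (- y / b) * y + (- y / b)^2 * b = - (1 / b * y^2)"
          by (simp add: field_simps power2_eq_square)
        moreover have "0 \<le> bil n F x x + 2 * (- y / b) * y + (- y / b)^2 * b"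
          using pos[of x "- y / b"] unfolding b_def y_def .
        ultimately show ?thesis unfolding e by linarith
      qed
    qed
  qed
  then obtain L where L: "\<forall>i<n. \<forall>j<n. F' i j = (\<Sum>k<n. L k i * L k j)" using Suc.IH by blast
  \<comment> \<open>The old vectors are extended by 0 at the new index, and the scaled last row
    becomes the new vector. For b = 0 division by zero makes that vector 0, in agreement with
    \<open>row0\<close>.\<close>
  define L' where "L' = (\<lambda>k i. if k = n then F n i / sqrt b else if i = n then 0 else L k i)"
  have "F i j = (\<Sum>k<Suc n. L' k i * L' k j)" if ij: "i < Suc n" "j < Suc n" for i j
  proof -
    have last: "L' n i * L' n j = F n i * F n j / b"
      using b0 by (simp add: L'_def)
    have sq: "F n i * F n n / b = F n i" if "i < Suc n" for i
    proof (cases "b = 0")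
      case True
      then have "F n i = 0" using row0[of i] that b_def less_Suc_eq by metis
      then show ?thesis by simp
    next
      case False
      then show ?thesis by (simp add: b_def)
    qed
    show ?thesis
    proof (cases "i < n \<and> j < n")
      case True
      then have "(\<Sum>k<n. L' k i * L' k j) = F' i j"
        using L by (auto simp: L'_def intro!: sum.cong)
      then show ?thesis using last by (simp add: F'_def)
    next
      case False
      then have "(\<Sum>k<n. L' k i * L' k j) = 0"
        using ij by (intro sum.neutral) (auto simp: L'_def)
      moreover have "F n i * F n j / b = F i j"
      proof (cases "i = n")
        case True
        then show ?thesis using sq[OF ij(2)] by (simp add: mult.commute)
      next
        case False
        with ij \<open>\<not> (i < n \<and> j < n)\<close> have "j = n" by auto
        then show ?thesis using sq[OF ij(1)] sym[OF ij] by metis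
      qed
      ultimately show ?thesis using last by simp
    qed
  qed
  then show ?case by blast
qed

lemma bil_unit:
  assumes "i < n" "j < n"
  shows "bil n F (\<lambda>k. of_bool (k = i)) (\<lambda>k. of_bool (k = j)) = F i j"
proof -
  have "bil n F (\<lambda>k. of_bool (k = i)) (\<lambda>k. of_bool (k = j)) =
      (\<Sum>k<n. if k = i then \<Sum>l<n. if l = j then F k l else 0 else 0)"
    unfolding bil_def by (intro sum.cong refl) (auto intro: sum.cong sum.neutral)
  then show ?thesis using assms by simp
qed

lemma psd_form_diag_nonneg: "psd_form n F \<Longrightarrow> i < n \<Longrightarrow> 0 \<le> F i i"
  using bil_unit[of i n i F] unfolding psd_form_def by metis

text \<open>Testing the form at the difference of two unit vectors bounds each entry by the mean of
  two diagonal entries. This keeps the supremum defining theta finite and settles the case of a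
  vanishing trace.\<close>

lemma psd_form_sum_le:
  assumes "psd_form n F"
  shows "(\<Sum>i<n. \<Sum>j<n. F i j) \<le> n * (\<Sum>i<n. F i i)"
proof -
  have sym: "\<And>i j. i < n \<Longrightarrow> j < n \<Longrightarrow> F i j = F j i" using assms unfolding psd_form_def by blast
  have "F i j \<le> (F i i + F j j) / 2" if "i < n" "j < n" for i j
  proof -
    have "0 \<le> bil n F (\<lambda>k. 1 * of_bool (k = i) + (-1) * of_bool (k = j))
                     (\<lambda>k. 1 * of_bool (k = i) + (-1) * of_bool (k = j))"
      using assms unfolding psd_form_def by blast
    also have "\<dots> = 1^2 * F i i + 2 * 1 * (-1) * F i j + (-1)^2 * F j j"
      by (subst bil_lincomb[OF sym]) (simp_all only: bil_unit that)
    finally show ?thesis by simp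
  qed
  then have "(\<Sum>i<n. \<Sum>j<n. F i j) \<le> (\<Sum>i<n. \<Sum>j<n. (F i i + F j j) / 2)"
    by (intro sum_mono) simp
  also have "\<dots> = n * (\<Sum>i<n. F i i)"
    by (simp add: sum.distrib add_divide_distrib sum_divide_distrib[symmetric] sum_distrib_left[symmetric])
  finally show ?thesis .
qed

text \<open>The Schur product theorem as monotonicity: a Gram decomposition of F turns the form of F
  o Q at u into a sum of values of the form of Q at the vectors u rescaled by the rows of L.\<close>

lemma psd_form_Hadamard_mono:
  assumes "psd_form n F" and le: "\<And>v. bil n P v v \<le> bil n M v v"
  shows "bil n (\<lambda>i j. F i j * P i j) u u \<le> bil n (\<lambda>i j. F i j * M i j) u u"
proof -
  obtain L where L: "\<And>i j. i < n \<Longrightarrow> j < n \<Longrightarrow> F i j = (\<Sum>k<n. L k i * L k j)"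
    using psd_form_Gram[OF assms(1)] by blast
  have e: "bil n (\<lambda>i j. F i j * Q i j) u u = (\<Sum>k<n. bil n Q (\<lambda>i. L k i * u i) (\<lambda>i. L k i * u i))" for Q
  proof -
    have "bil n (\<lambda>i j. F i j * Q i j) u u = (\<Sum>i<n. \<Sum>j<n. \<Sum>k<n. L k i * u i * Q i j * (L k j * u j))"
      unfolding bil_def
      by (intro sum.cong refl) (simp add: L sum_distrib_left sum_distrib_right mult_ac)
    also have "\<dots> = (\<Sum>i<n. \<Sum>k<n. \<Sum>j<n. L k i * u i * Q i j * (L k j * u j))"
      by (intro sum.cong refl sum.swap)
    also have "\<dots> = (\<Sum>k<n. bil n Q (\<lambda>i. L k i * u i) (\<lambda>i. L k i * u i))"
      unfolding bil_def by (rule sum.swap)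
    finally show ?thesis .
  qed
  show ?thesis unfolding e by (intro sum_mono le)
qed

section \<open>Pauli strings\<close>

text \<open>The distributive law for a product of two-term sums, where the binary digits of m encode
  which summand each factor contributes. The induction separates the numbers by their top
  digit.\<close>

lemma sum_prod_binary_digits:
  fixes f :: "nat \<Rightarrow> nat \<Rightarrow> 'a::comm_semiring_1"
  shows "(\<Sum>m<2^q. \<Prod>k<q. f k (m div 2^k mod 2)) = (\<Prod>k<q. f k 0 + f k 1)"
proof (induction q)
  case 0
  show ?case by simp
next
  case (Suc q)
  let ?g = "\<lambda>m. \<Prod>k<q. f k (m div 2^k mod 2)"
  have low: "(\<Prod>k<Suc q. f k (m div 2^k mod 2)) = ?g m * f q 0" if "m < 2^q" for m
    using that by simp
  have high: "(\<Prod>k<Suc q. f k ((m + 2^q) div 2^k mod 2)) = ?g m * f q 1" if "m < 2^q" for m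
  proof -
    have "(m + 2^q) div 2^k mod 2 = m div 2^k mod 2" if "k < q" for k
    proof -
      \<comment> \<open>For k < q the number 2^q is an even multiple of 2^k, so adding it leaves
        digit k unchanged.\<close>
      have "(2::nat)^q = 2^k * (2 * 2^(q-k-1))"
        using that by (simp flip: power_Suc power_add)
      then have "(m + 2^q) div 2^k = m div 2^k + 2 * 2^(q-k-1)" by simp
      then show ?thesis by simp
    qed
    moreover have "(m + 2^q) div 2^q mod 2 = 1" using \<open>m < 2^q\<close> by simp
    ultimately show ?thesis by simp
  qed
  have "(\<Sum>m<2^Suc q. \<Prod>k<Suc q. f k (m div 2^k mod 2)) =
      (\<Sum>m<2^q. \<Prod>k<Suc q. f k (m div 2^k mod 2)) +
      (\<Sum>m\<in>{2^q..<2^q + 2^q}. \<Prod>k<Suc q. f k (m div 2^k mod 2))"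
    unfolding lessThan_atLeast0 power_Suc mult_2 by (rule sum.atLeastLessThan_concat[symmetric]) simp_all
  also have "(\<Sum>m\<in>{2^q..<2^q + 2^q}. \<Prod>k<Suc q. f k (m div 2^k mod 2)) =
      (\<Sum>m<2^q. \<Prod>k<Suc q. f k ((m + 2^q) div 2^k mod 2))"
    using sum.shift_bounds_nat_ivl[of "\<lambda>m. \<Prod>k<Suc q. f k (m div 2^k mod 2)" 0 "2^q" "2^q"]
    by (simp add: atLeast0LessThan del: prod.lessThan_Suc)
  also have "(\<Sum>m<2^q. \<Prod>k<Suc q. f k (m div 2^k mod 2)) = (\<Sum>m<2^q. ?g m * f q 0)"
    by (intro sum.cong refl low) simp
  also have "(\<Sum>m<2^q. \<Prod>k<Suc q. f k ((m + 2^q) div 2^k mod 2)) = (\<Sum>m<2^q. ?g m * f q 1)"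
    by (intro sum.cong refl high) simp
  finally show ?case
    using Suc.IH by (simp flip: sum_distrib_right add: distrib_left)
qed

text \<open>Needed for off-diagonal entries of a tensor product of identities: distinct indices
  differ in some digit, which contributes a factor 0. The induction strips the lowest digit.\<close>

lemma binary_digits_eqI:
  assumes "(i::nat) < 2^q" "j < 2^q" "\<And>k. k < q \<Longrightarrow> i div 2^k mod 2 = j div 2^k mod 2"
  shows "i = j"
  using assms
proof (induction q arbitrary: i j)
  case 0
  then show ?case by simp
next
  case (Suc q)
  have "i div 2 = j div 2"
  proof (rule Suc.IH)
    show "i div 2 < 2^q" "j div 2 < 2^q" using Suc.prems(1,2) by auto
    show "i div 2 div 2^k mod 2 = j div 2 div 2^k mod 2" if "k < q" for k
      using Suc.prems(3)[of "Suc k"] that by (simp add: div_mult2_eq)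
  qed
  moreover have "i mod 2 = j mod 2" using Suc.prems(3)[of 0] by simp
  ultimately show ?case by (metis div_mult_mod_eq)
qed

section \<open>Single-qubit Pauli matrices\<close>

lemma pauli1_index:
  "pauli1 a $$ (0,0) = (if a = 1 \<or> a = 2 then 0 else 1)"
  "pauli1 a $$ (0,1) = (if a = 1 then 1 else if a = 2 then -\<i> else 0)"
  "pauli1 a $$ (1,0) = (if a = 1 then 1 else if a = 2 then \<i> else 0)"
  "pauli1 a $$ (1,1) = (if a = 1 \<or> a = 2 then 0 else if a = 3 then -1 else 1)"
  by (simp_all add: pauli1_def mat_of_rows_list_def)

lemma pauli1_hermitian: "x < 2 \<Longrightarrow> y < 2 \<Longrightarrow> pauli1 a $$ (x,y) = cnj (pauli1 a $$ (y,x))"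
  unfolding less_2_cases_iff by (elim disjE) (simp_all add: pauli1_index[simplified])

lemma pauli1_square:
  "x < 2 \<Longrightarrow> y < 2 \<Longrightarrow>
   pauli1 a $$ (x,0) * pauli1 a $$ (0,y) + pauli1 a $$ (x,1) * pauli1 a $$ (1,y) = (if x = y then 1 else 0)"
  unfolding less_2_cases_iff by (elim disjE) (simp_all add: pauli1_index[simplified])

lemma pauli1_commute_or_anticommute:
  "\<exists>s\<in>{1,-1}. \<forall>x<2. \<forall>y<2.
   pauli1 a $$ (x,0) * pauli1 b $$ (0,y) + pauli1 a $$ (x,1) * pauli1 b $$ (1,y) =
   s * (pauli1 b $$ (x,0) * pauli1 a $$ (0,y) + pauli1 b $$ (x,1) * pauli1 a $$ (1,y))"
proof
  \<comment> \<open>Every code outside 1, 2, 3 denotes the identity, so only two distinct codes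
    among 1, 2, 3 anticommute.\<close>
  let ?s = "if a = b \<or> a \<notin> {1,2,3} \<or> b \<notin> {1,2,3} then 1 else -1 :: complex"
  show "?s \<in> {1,-1}" by simp
  have "a = 1 \<or> a = 2 \<or> a = 3 \<or> a \<notin> {1,2,3}" "b = 1 \<or> b = 2 \<or> b = 3 \<or> b \<notin> {1,2,3}"
    by auto
  moreover have "(\<forall>x<2. P x) \<longleftrightarrow> P 0 \<and> P 1" for P :: "nat \<Rightarrow> bool"
    by (auto simp: less_2_cases_iff)
  ultimately show "\<forall>x<2. \<forall>y<2.
   pauli1 a $$ (x,0) * pauli1 b $$ (0,y) + pauli1 a $$ (x,1) * pauli1 b $$ (1,y) =
   ?s * (pauli1 b $$ (x,0) * pauli1 a $$ (0,y) + pauli1 b $$ (x,1) * pauli1 a $$ (1,y))"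
    by (elim disjE) (simp_all add: pauli1_index del: One_nat_def)
qed

lemma pauli_string_carrier [simp]: "pauli_string q p \<in> carrier_mat (2^q) (2^q)"
  by (simp add: pauli_string_def)

lemma pauli_string_dim [simp]: "dim_row (pauli_string q p) = 2^q" "dim_col (pauli_string q p) = 2^q"
  by (simp_all add: pauli_string_def)

lemma pauli_string_hermitian:
  "i < 2^q \<Longrightarrow> j < 2^q \<Longrightarrow> pauli_string q p $$ (i,j) = cnj (pauli_string q p $$ (j,i))"
  by (auto simp: pauli_string_def intro!: prod.cong pauli1_hermitian)

text \<open>The mixed-product rule for Kronecker products: strings multiply qubit by qubit, which
  reduces their algebra to 2 by 2 matrices.\<close>

lemma pauli_string_mult_index:
  assumes "i < 2^q" "j < 2^q"
  shows "(pauli_string q p * pauli_string q p') $$ (i,j) =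
    (\<Prod>k<q. pauli1 (p k) $$ (i div 2^k mod 2, 0) * pauli1 (p' k) $$ (0, j div 2^k mod 2) +
           pauli1 (p k) $$ (i div 2^k mod 2, 1) * pauli1 (p' k) $$ (1, j div 2^k mod 2))"
proof -
  have "(pauli_string q p * pauli_string q p') $$ (i,j) =
      (\<Sum>m<2^q. pauli_string q p $$ (i,m) * pauli_string q p' $$ (m,j))"
    using assms by (simp add: scalar_prod_def atLeast0LessThan)
  also have "\<dots> = (\<Sum>m<2^q. \<Prod>k<q. pauli1 (p k) $$ (i div 2^k mod 2, m div 2^k mod 2) *
      pauli1 (p' k) $$ (m div 2^k mod 2, j div 2^k mod 2))"
    using assms by (intro sum.cong refl) (simp add: pauli_string_def prod.distrib)
  also have "\<dots> = (\<Prod>k<q. pauli1 (p k) $$ (i div 2^k mod 2, 0) * pauli1 (p' k) $$ (0, j div 2^k mod 2) +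
           pauli1 (p k) $$ (i div 2^k mod 2, 1) * pauli1 (p' k) $$ (1, j div 2^k mod 2))"
    by (rule sum_prod_binary_digits)
  finally show ?thesis .
qed

lemma pauli_string_square: "pauli_string q p * pauli_string q p = 1\<^sub>m (2^q)"
proof (rule eq_matI)
  fix i j assume "i < dim_row (1\<^sub>m (2^q) :: complex mat)" "j < dim_col (1\<^sub>m (2^q) :: complex mat)"
  then have ij: "i < 2^q" "j < 2^q" by auto
  have "(pauli_string q p * pauli_string q p) $$ (i,j) =
      (\<Prod>k<q. if i div 2^k mod 2 = j div 2^k mod 2 then 1 else 0)"
    unfolding pauli_string_mult_index[OF ij] by (intro prod.cong refl pauli1_square) auto
  also have "\<dots> = (if i = j then 1 else 0)"
    using binary_digits_eqI[OF ij] by (auto intro!: prod.neutral)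
  finally show "(pauli_string q p * pauli_string q p) $$ (i,j) = 1\<^sub>m (2^q) $$ (i,j)" using ij by simp
qed simp_all

text \<open>The signs of the single qubits multiply to one global sign. A realization only says that
  non-adjacent strings do not anticommute; this dichotomy makes them commute.\<close>

lemma pauli_string_commute_or_anticommute:
  "pauli_string q p * pauli_string q p' = pauli_string q p' * pauli_string q p \<or>
   pauli_string q p * pauli_string q p' = - (pauli_string q p' * pauli_string q p)"
proof -
  have "\<forall>k. \<exists>s. s \<in> {1,-1} \<and> (\<forall>x<2. \<forall>y<2.
       pauli1 (p k) $$ (x,0) * pauli1 (p' k) $$ (0,y) + pauli1 (p k) $$ (x,1) * pauli1 (p' k) $$ (1,y) =
       s * (pauli1 (p' k) $$ (x,0) * pauli1 (p k) $$ (0,y) + pauli1 (p' k) $$ (x,1) * pauli1 (p k) $$ (1,y)))"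
    using pauli1_commute_or_anticommute by (auto simp only: Bex_def)
  from choice[OF this] obtain s where s: "\<And>k. s k \<in> {1,-1}"
    "\<And>k x y. x < 2 \<Longrightarrow> y < 2 \<Longrightarrow>
       pauli1 (p k) $$ (x,0) * pauli1 (p' k) $$ (0,y) + pauli1 (p k) $$ (x,1) * pauli1 (p' k) $$ (1,y) =
       s k * (pauli1 (p' k) $$ (x,0) * pauli1 (p k) $$ (0,y) + pauli1 (p' k) $$ (x,1) * pauli1 (p k) $$ (1,y))"
    by blast
  define t where "t = (\<Prod>k<q. s k)"
  have t: "t \<in> {1,-1}"
    unfolding t_def by (induction q) (use s(1) in force)+
  have "(pauli_string q p * pauli_string q p') $$ (i,j) = t * (pauli_string q p' * pauli_string q p) $$ (i,j)"
    if "i < 2^q" "j < 2^q" for i j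
    unfolding pauli_string_mult_index[OF that] t_def prod.distrib[symmetric]
    by (intro prod.cong refl s(2)) auto
  then have e: "pauli_string q p * pauli_string q p' = t \<cdot>\<^sub>m (pauli_string q p' * pauli_string q p)"
    by (intro eq_matI) (simp_all only: index_smult_mat dim_row_mat index_mult_mat(2,3) pauli_string_dim)
  show ?thesis
  proof (cases "t = 1")
    case True
    have "1 \<cdot>\<^sub>m (pauli_string q p' * pauli_string q p) = pauli_string q p' * pauli_string q p"
      by (rule eq_matI) simp_all
    then show ?thesis using e True by metis
  next
    case False
    have "(-1) \<cdot>\<^sub>m (pauli_string q p' * pauli_string q p) = - (pauli_string q p' * pauli_string q p)"
      by (rule eq_matI) simp_all
    then show ?thesis using e False t by (metis insertE singletonD)
  qed
qed

section \<open>States and moment matrices\<close>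

lemma mat_trace_mult:
  assumes "A \<in> carrier_mat d d" "B \<in> carrier_mat d d"
  shows "mat_trace (A * B) = (\<Sum>a<d. \<Sum>b<d. A $$ (a,b) * B $$ (b,a))"
  using assms by (auto simp: mat_trace_def scalar_prod_def atLeast0LessThan intro!: sum.cong)

text \<open>The sum is the trace of \<rho> times C times the adjoint of C. It splits over the
  columns of C, each contributing one value of the nonnegative form of \<rho>.\<close>

lemma density_matrix_Gram_nonneg:
  assumes "density_matrix d \<rho>"
  shows "0 \<le> Re (\<Sum>a<d. \<Sum>b<d. \<rho> $$ (a,b) * (\<Sum>k<d. C b k * cnj (C a k)))"
proof -
  have "(\<Sum>a<d. \<Sum>b<d. \<rho> $$ (a,b) * (\<Sum>k<d. C b k * cnj (C a k))) =
      (\<Sum>a<d. \<Sum>k<d. \<Sum>b<d. cnj (C a k) * \<rho> $$ (a,b) * C b k)"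
    unfolding sum_distrib_left by (subst sum.swap) (intro sum.cong refl, simp add: mult_ac)
  also have "\<dots> = (\<Sum>k<d. \<Sum>a<d. \<Sum>b<d. cnj (C a k) * \<rho> $$ (a,b) * C b k)"
    by (rule sum.swap)
  finally have e: "(\<Sum>a<d. \<Sum>b<d. \<rho> $$ (a,b) * (\<Sum>k<d. C b k * cnj (C a k))) =
      (\<Sum>k<d. \<Sum>a<d. \<Sum>b<d. cnj (C a k) * \<rho> $$ (a,b) * C b k)" .
  have "0 \<le> Re (\<Sum>a<d. \<Sum>b<d. cnj (C a k) * \<rho> $$ (a,b) * C b k)" for k
    using assms unfolding density_matrix_def by (elim conjE) (erule spec[of _ "\<lambda>a. C a k"])
  then show ?thesis
    unfolding e by (subst Re_sum) (rule sum_nonneg)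
qed

text \<open>For the observable A = sum of u_i S_i with mean t, this is nonnegativity of the
  variance: the trace of \<rho> (A - t)^2 is at least 0. As u varies, it says that the rank-one
  matrix of expectations lies below the real moment matrix.\<close>

lemma moment_matrix_inequality:
  fixes S :: "nat \<Rightarrow> complex mat" and u :: "nat \<Rightarrow> real"
  assumes \<rho>: "density_matrix d \<rho>"
    and S: "\<And>i. i < n \<Longrightarrow> S i \<in> carrier_mat d d"
    and herm: "\<And>i a b. i < n \<Longrightarrow> a < d \<Longrightarrow> b < d \<Longrightarrow> S i $$ (a,b) = cnj (S i $$ (b,a))"
  shows "(\<Sum>i<n. u i * Re (mat_trace (\<rho> * S i)))^2 \<le>
         bil n (\<lambda>i j. Re (mat_trace (\<rho> * (S i * S j)))) u u"
proof -
  have \<rho>c: "\<rho> \<in> carrier_mat d d" and tr1: "mat_trace \<rho> = 1"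
    using \<rho> unfolding density_matrix_def by blast+
  \<comment> \<open>\<open>T\<close> X is the trace of \<rho> X, \<open>A\<close> the observable,
    \<open>\<delta>\<close> the identity and \<open>C\<close> the centred observable. Since t is
    real and \<open>A\<close> Hermitian, \<open>C\<close> times its adjoint is its square.\<close>
  define T where "T X = (\<Sum>a<d. \<Sum>b<d. \<rho> $$ (a,b) * X b a)" for X :: "nat \<Rightarrow> nat \<Rightarrow> complex"
  define t where "t = (\<Sum>i<n. u i * Re (mat_trace (\<rho> * S i)))"
  define A where "A b k = (\<Sum>i<n. of_real (u i) * S i $$ (b,k))" for b k
  define \<delta> where "\<delta> b k = (if b = k then 1 else 0 :: complex)" for b k :: nat
  define C where "C b k = A b k - of_real t * \<delta> b k" for b k
  define A2 where "A2 b a = (\<Sum>k<d. A b k * A k a)" for b a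
  have cA: "cnj (A a k) = A k a" if "a < d" "k < d" for a k
    unfolding A_def cnj_sum
    by (intro sum.cong refl) (simp add: herm[OF _ that(2,1), symmetric])
  have "(\<Sum>k<d. C b k * cnj (C a k)) = A2 b a - 2 * of_real t * A b a + of_real (t^2) * \<delta> b a"
    if "a < d" "b < d" for a b
  proof -
    have "(\<Sum>k<d. C b k * cnj (C a k)) = (\<Sum>k<d. C b k * C k a)"
      using that by (intro sum.cong refl) (auto simp: C_def cA \<delta>_def)
    also have "\<dots> = (\<Sum>k<d. A b k * A k a - of_real t * (if k = a then A b k else 0)
        - of_real t * (if b = k then A k a else 0) + of_real (t^2) * (if b = k then \<delta> k a else 0))"
      by (intro sum.cong refl) (simp add: C_def \<delta>_def algebra_simps power2_eq_square)
    also have "\<dots> = A2 b a - 2 * of_real t * A b a + of_real (t^2) * \<delta> b a"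
      using that by (simp add: sum.distrib sum_subtractf A2_def flip: sum_distrib_left)
    finally show ?thesis .
  qed
  then have "(\<Sum>a<d. \<Sum>b<d. \<rho> $$ (a,b) * (\<Sum>k<d. C b k * cnj (C a k))) =
      T (\<lambda>b a. A2 b a - 2 * of_real t * A b a + of_real (t^2) * \<delta> b a)"
    unfolding T_def by (intro sum.cong refl) simp
  then have "0 \<le> Re (T (\<lambda>b a. A2 b a - 2 * of_real t * A b a + of_real (t^2) * \<delta> b a))"
    using density_matrix_Gram_nonneg[OF \<rho>, of C] by metis
  also have "T (\<lambda>b a. A2 b a - 2 * of_real t * A b a + of_real (t^2) * \<delta> b a) =
      T A2 - 2 * of_real t * T A + of_real (t^2) * T \<delta>"
    unfolding T_def by (simp add: sum.distrib sum_subtractf sum_distrib_left algebra_simps)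
  also have "T \<delta> = 1"
  proof -
    have "T \<delta> = mat_trace \<rho>"
      using \<rho>c unfolding T_def \<delta>_def mat_trace_def
      by (auto intro!: sum.cong simp: if_distrib[of "\<lambda>x. _ * x"] cong: if_cong)
    then show ?thesis using tr1 by simp
  qed
  also have "T A = (\<Sum>i<n. of_real (u i) * mat_trace (\<rho> * S i))"
  proof -
    have "T A = (\<Sum>a<d. \<Sum>b<d. \<Sum>i<n. of_real (u i) * (\<rho> $$ (a,b) * S i $$ (b,a)))"
      unfolding T_def A_def sum_distrib_left by (simp add: mult_ac)
    also have "\<dots> = (\<Sum>a<d. \<Sum>i<n. \<Sum>b<d. of_real (u i) * (\<rho> $$ (a,b) * S i $$ (b,a)))"
      by (intro sum.cong refl sum.swap)
    also have "\<dots> = (\<Sum>i<n. \<Sum>a<d. \<Sum>b<d. of_real (u i) * (\<rho> $$ (a,b) * S i $$ (b,a)))"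
      by (rule sum.swap)
    also have "\<dots> = (\<Sum>i<n. of_real (u i) * mat_trace (\<rho> * S i))"
      by (intro sum.cong refl) (simp add: mat_trace_mult[OF \<rho>c S] sum_distrib_left)
    finally show ?thesis .
  qed
  also have "T A2 = (\<Sum>i<n. \<Sum>j<n. of_real (u i * u j) * mat_trace (\<rho> * (S i * S j)))"
  proof -
    have A2: "A2 b a = (\<Sum>i<n. \<Sum>j<n. of_real (u i * u j) * (S i * S j) $$ (b,a))"
      if "a < d" "b < d" for a b
    proof -
      have "A2 b a = (\<Sum>k<d. \<Sum>i<n. \<Sum>j<n. of_real (u i * u j) * (S i $$ (b,k) * S j $$ (k,a)))"
        unfolding A2_def A_def sum_product by (simp add: mult_ac)
      also have "\<dots> = (\<Sum>i<n. \<Sum>k<d. \<Sum>j<n. of_real (u i * u j) * (S i $$ (b,k) * S j $$ (k,a)))"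
        by (rule sum.swap)
      also have "\<dots> = (\<Sum>i<n. \<Sum>j<n. \<Sum>k<d. of_real (u i * u j) * (S i $$ (b,k) * S j $$ (k,a)))"
        by (intro sum.cong refl sum.swap)
      also have "\<dots> = (\<Sum>i<n. \<Sum>j<n. of_real (u i * u j) * (S i * S j) $$ (b,a))"
      proof (intro sum.cong refl)
        fix i j assume "i \<in> {..<n}" "j \<in> {..<n}"
        then have "S i \<in> carrier_mat d d" "S j \<in> carrier_mat d d" using S by auto
        then show "(\<Sum>k<d. of_real (u i * u j) * (S i $$ (b,k) * S j $$ (k,a))) =
            of_real (u i * u j) * (S i * S j) $$ (b,a)"
          using that by (simp add: scalar_prod_def atLeast0LessThan sum_distrib_left)
      qed
      finally show ?thesis .
    qed
    have "T A2 = (\<Sum>a<d. \<Sum>b<d. \<Sum>i<n. \<Sum>j<n. of_real (u i * u j) * (\<rho> $$ (a,b) * (S i * S j) $$ (b,a)))"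
      unfolding T_def by (intro sum.cong refl) (simp add: A2 sum_distrib_left mult_ac)
    also have "\<dots> = (\<Sum>a<d. \<Sum>i<n. \<Sum>b<d. \<Sum>j<n. of_real (u i * u j) * (\<rho> $$ (a,b) * (S i * S j) $$ (b,a)))"
      by (intro sum.cong refl sum.swap)
    also have "\<dots> = (\<Sum>i<n. \<Sum>a<d. \<Sum>b<d. \<Sum>j<n. of_real (u i * u j) * (\<rho> $$ (a,b) * (S i * S j) $$ (b,a)))"
      by (rule sum.swap)
    also have "\<dots> = (\<Sum>i<n. \<Sum>a<d. \<Sum>j<n. \<Sum>b<d. of_real (u i * u j) * (\<rho> $$ (a,b) * (S i * S j) $$ (b,a)))"
      by (intro sum.cong refl sum.swap)
    also have "\<dots> = (\<Sum>i<n. \<Sum>j<n. \<Sum>a<d. \<Sum>b<d. of_real (u i * u j) * (\<rho> $$ (a,b) * (S i * S j) $$ (b,a)))"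
      by (intro sum.cong refl sum.swap)
    also have "\<dots> = (\<Sum>i<n. \<Sum>j<n. of_real (u i * u j) * mat_trace (\<rho> * (S i * S j)))"
    proof (intro sum.cong refl)
      fix i j assume "i \<in> {..<n}" "j \<in> {..<n}"
      then have "S i * S j \<in> carrier_mat d d" using S by (meson lessThan_iff mult_carrier_mat)
      then show "(\<Sum>a<d. \<Sum>b<d. of_real (u i * u j) * (\<rho> $$ (a,b) * (S i * S j) $$ (b,a))) =
          of_real (u i * u j) * mat_trace (\<rho> * (S i * S j))"
        by (simp add: mat_trace_mult[OF \<rho>c] sum_distrib_left)
    qed
    finally show ?thesis .
  qed
  finally have "0 \<le> Re ((\<Sum>i<n. \<Sum>j<n. of_real (u i * u j) * mat_trace (\<rho> * (S i * S j)))
      - 2 * of_real t * (\<Sum>i<n. of_real (u i) * mat_trace (\<rho> * S i)) + of_real (t^2))"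
    by simp
  also have "\<dots> = bil n (\<lambda>i j. Re (mat_trace (\<rho> * (S i * S j)))) u u - 2 * t * t + t^2"
    by (simp add: bil_def t_def mult_ac del: of_real_mult)
  finally show ?thesis by (simp add: t_def power2_eq_square)
qed

text \<open>For Hermitian matrices the traces of \<rho> A B and \<rho> B A are complex conjugates,
  while anticommutation makes them negatives of each other. Hence the real moment matrix vanishes on
  the edges of G.\<close>

lemma trace_anticommuting:
  fixes A B :: "complex mat"
  assumes \<rho>: "density_matrix d \<rho>"
    and A: "A \<in> carrier_mat d d" "\<And>a b. a < d \<Longrightarrow> b < d \<Longrightarrow> A $$ (a,b) = cnj (A $$ (b,a))"
    and B: "B \<in> carrier_mat d d" "\<And>a b. a < d \<Longrightarrow> b < d \<Longrightarrow> B $$ (a,b) = cnj (B $$ (b,a))"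
    and "A * B = - (B * A)"
  shows "Re (mat_trace (\<rho> * (A * B))) = 0"
proof -
  have \<rho>c: "\<rho> \<in> carrier_mat d d" and \<rho>h: "\<And>a b. a < d \<Longrightarrow> b < d \<Longrightarrow> \<rho> $$ (a,b) = cnj (\<rho> $$ (b,a))"
    using \<rho> unfolding density_matrix_def by blast+
  have AB: "A * B \<in> carrier_mat d d" "B * A \<in> carrier_mat d d" using A B by auto
  have h: "(A * B) $$ (b,a) = cnj ((B * A) $$ (a,b))" if "a < d" "b < d" for a b
    using that A(1) B(1)
    by (simp add: scalar_prod_def atLeast0LessThan)
       (intro sum.cong refl, metis A(2) B(2) lessThan_iff mult.commute)
  have "mat_trace (\<rho> * (A * B)) = (\<Sum>a<d. \<Sum>b<d. \<rho> $$ (a,b) * (A * B) $$ (b,a))"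
    by (rule mat_trace_mult[OF \<rho>c AB(1)])
  also have "\<dots> = (\<Sum>a<d. \<Sum>b<d. cnj (\<rho> $$ (b,a) * (B * A) $$ (a,b)))"
    by (intro sum.cong refl) (simp add: h[symmetric] \<rho>h[symmetric])
  also have "\<dots> = cnj (mat_trace (\<rho> * (B * A)))"
    unfolding mat_trace_mult[OF \<rho>c AB(2)] by (subst sum.swap) simp
  finally have 1: "Re (mat_trace (\<rho> * (A * B))) = Re (mat_trace (\<rho> * (B * A)))" by simp
  have "mat_trace (\<rho> * (A * B)) = - mat_trace (\<rho> * (B * A))"
    unfolding mat_trace_mult[OF \<rho>c AB(1)] mat_trace_mult[OF \<rho>c AB(2)]
    using AB A(1) B(1) by (simp add: \<open>A * B = _\<close> flip: sum_negf)
  then show ?thesis using 1 by simp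
qed

text \<open>Induction over the index set: 1 + c S_k maps a joint eigenvector of the earlier matrices
  to another one, because S_k commutes with them, and S_k^2 = 1 makes the image an eigenvector of
  S_k.\<close>

lemma joint_eigenvector:
  fixes S :: "nat \<Rightarrow> complex mat"
  assumes "finite I" "d > 0"
    and "\<And>i. i \<in> I \<Longrightarrow> S i \<in> carrier_mat d d"
    and "\<And>i. i \<in> I \<Longrightarrow> S i * S i = 1\<^sub>m d"
    and "\<And>i j. i \<in> I \<Longrightarrow> j \<in> I \<Longrightarrow> S i * S j = S j * S i"
  shows "\<exists>v s. v \<in> carrier_vec d \<and> v \<noteq> 0\<^sub>v d \<and> (\<forall>i\<in>I. s i \<in> {1,-1} \<and> S i *\<^sub>v v = s i \<cdot>\<^sub>v v)"
  using assms
proof (induction I rule: finite_induct)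
  case empty
  have "unit_vec d 0 \<noteq> (0\<^sub>v d :: complex vec)" using \<open>d > 0\<close> by simp
  then show ?case using unit_vec_carrier by blast
next
  case (insert k I)
  have "\<exists>v s. v \<in> carrier_vec d \<and> v \<noteq> 0\<^sub>v d \<and> (\<forall>i\<in>I. s i \<in> {1,-1} \<and> S i *\<^sub>v v = s i \<cdot>\<^sub>v v)"
    by (rule insert.IH) (use insert.prems in simp_all)
  then obtain v s where v: "v \<in> carrier_vec d" "v \<noteq> 0\<^sub>v d"
    and s: "\<And>i. i \<in> I \<Longrightarrow> s i \<in> {1,-1}" "\<And>i. i \<in> I \<Longrightarrow> S i *\<^sub>v v = s i \<cdot>\<^sub>v v"
    by blast
  have Sk: "S k \<in> carrier_mat d d" "S k * S k = 1\<^sub>m d" using insert by auto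
  have Skv: "S k *\<^sub>v v \<in> carrier_vec d" using Sk v by auto
  \<comment> \<open>v is half the sum of the two candidate eigenvectors v + Sv and v - Sv, so one of them is nonzero.\<close>
  define w where "w c = v + c \<cdot>\<^sub>v (S k *\<^sub>v v)" for c :: complex
  have wc: "w c \<in> carrier_vec d" for c using v Skv by (auto simp: w_def)
  have "\<exists>c\<in>{1,-1}. w c \<noteq> 0\<^sub>v d"
  proof (rule ccontr)
    assume "\<not> ?thesis"
    then have *: "w 1 = 0\<^sub>v d" "w (-1) = 0\<^sub>v d" by auto
    have "v $ a = 0" if "a < d" for a
    proof -
      have "w 1 $ a + w (-1) $ a = 2 * v $ a"
        using that v Skv Sk unfolding w_def by (simp del: index_mult_mat_vec)
      then show ?thesis using that * by simp
    qed
    then have "v = 0\<^sub>v d" using v by (intro eq_vecI) auto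
    then show False using v by simp
  qed
  then obtain c where c: "c \<in> {1,-1}" "w c \<noteq> 0\<^sub>v d" by blast
  have "S k *\<^sub>v w c = S k *\<^sub>v v + c \<cdot>\<^sub>v (S k *\<^sub>v (S k *\<^sub>v v))"
    using Sk v Skv unfolding w_def
    by (simp add: mult_add_distrib_mat_vec[of _ d d] mult_mat_vec[of _ d d])
  also have "S k *\<^sub>v (S k *\<^sub>v v) = v"
    using assoc_mult_mat_vec[OF Sk(1) Sk(1) v(1)] Sk v by simp
  \<comment> \<open>Here c * c = 1 is used, so c is both the coefficient and the eigenvalue.\<close>
  also have "S k *\<^sub>v v + c \<cdot>\<^sub>v v = c \<cdot>\<^sub>v w c"
    using c v Skv Sk unfolding w_def by (intro eq_vecI) auto
  finally have k: "S k *\<^sub>v w c = c \<cdot>\<^sub>v w c" .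
  have "S i *\<^sub>v w c = s i \<cdot>\<^sub>v w c" if "i \<in> I" for i
  proof -
    have Si: "S i \<in> carrier_mat d d" "S i * S k = S k * S i" using insert.prems that by auto
    have "S i *\<^sub>v (S k *\<^sub>v v) = S k *\<^sub>v (S i *\<^sub>v v)"
      using assoc_mult_mat_vec[OF Si(1) Sk(1) v(1)] assoc_mult_mat_vec[OF Sk(1) Si(1) v(1)] Si(2) by simp
    also have "\<dots> = s i \<cdot>\<^sub>v (S k *\<^sub>v v)"
      using s(2)[OF that] Sk v by (simp add: mult_mat_vec[of _ d d])
    finally have "S i *\<^sub>v w c = s i \<cdot>\<^sub>v v + c \<cdot>\<^sub>v (s i \<cdot>\<^sub>v (S k *\<^sub>v v))"
      using Si Sk v Skv s(2)[OF that] unfolding w_def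
      by (simp add: mult_add_distrib_mat_vec[of _ d d] mult_mat_vec[of _ d d])
    also have "\<dots> = s i \<cdot>\<^sub>v w c"
      using v Sk(1) unfolding w_def by (intro eq_vecI) (auto simp: algebra_simps)
    finally show ?thesis .
  qed
  then have "\<forall>i\<in>insert k I. (s(k := c)) i \<in> {1,-1} \<and> S i *\<^sub>v w c = (s(k := c)) i \<cdot>\<^sub>v w c"
    using k c s insert.hyps by auto
  then show ?case using wc c by blast
qed

text \<open>\<rho> is the orthogonal projector onto the line of v, so the expectation at an
  eigenvector is its eigenvalue.\<close>

lemma pure_state:
  fixes v :: "complex vec"
  assumes v: "v \<in> carrier_vec d" "v \<noteq> 0\<^sub>v d"
  defines "\<rho> \<equiv> mat d d (\<lambda>(a,b). v $ a * cnj (v $ b) / of_real (\<Sum>k<d. (cmod (v $ k))^2))"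
  shows "density_matrix d \<rho>"
    and "A \<in> carrier_mat d d \<Longrightarrow> A *\<^sub>v v = c \<cdot>\<^sub>v v \<Longrightarrow> mat_trace (\<rho> * A) = c"
proof -
  define N where "N = (\<Sum>k<d. (cmod (v $ k))^2)"
  obtain k where k: "k < d" "v $ k \<noteq> 0" using v by (metis eq_vecI carrier_vecD index_zero_vec)
  then have "0 < (cmod (v $ k))^2" by simp
  also have "\<dots> \<le> N" unfolding N_def using k by (intro member_le_sum) auto
  finally have N: "N > 0" .
  have sumN: "(\<Sum>a<d. v $ a * cnj (v $ a)) = of_real N"
    unfolding N_def of_real_sum complex_norm_square ..
  have \<rho>: "\<rho> \<in> carrier_mat d d" by (simp add: \<rho>_def)
  have \<rho>i: "\<rho> $$ (a,b) = v $ a * cnj (v $ b) / of_real N" if "a < d" "b < d" for a b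
    using that by (simp add: \<rho>_def N_def)
  have "mat_trace \<rho> = 1"
    using \<rho> N by (simp add: mat_trace_def \<rho>i sumN flip: sum_divide_distrib)
  moreover have "0 \<le> Re (\<Sum>i<d. \<Sum>j<d. cnj (x i) * \<rho> $$ (i,j) * x j)" for x
  proof -
    define z where "z = (\<Sum>i<d. cnj (x i) * v $ i)"
    have "(\<Sum>i<d. \<Sum>j<d. cnj (x i) * \<rho> $$ (i,j) * x j) = z * cnj z / of_real N"
      unfolding z_def cnj_sum sum_product sum_divide_distrib
      by (intro sum.cong refl) (simp add: \<rho>i)
    also have "\<dots> = of_real ((cmod z)^2 / N)" by (simp only: of_real_divide complex_norm_square)
    finally show ?thesis using N by simp
  qed
  ultimately show "density_matrix d \<rho>"
    using \<rho> by (auto simp: density_matrix_def \<rho>i)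
  assume A: "A \<in> carrier_mat d d" "A *\<^sub>v v = c \<cdot>\<^sub>v v"
  have row: "(\<Sum>a<d. A $$ (b,a) * v $ a) = c * v $ b" if "b < d" for b
  proof -
    have "(A *\<^sub>v v) $ b = (\<Sum>a<d. A $$ (b,a) * v $ a)"
      using that A(1) v by (simp add: scalar_prod_def atLeast0LessThan)
    then show ?thesis using A that v by simp
  qed
  have "mat_trace (\<rho> * A) = (\<Sum>b<d. \<Sum>a<d. \<rho> $$ (a,b) * A $$ (b,a))"
    unfolding mat_trace_mult[OF \<rho> A(1)] by (rule sum.swap)
  also have "\<dots> = (\<Sum>b<d. cnj (v $ b) * (\<Sum>a<d. A $$ (b,a) * v $ a) / of_real N)"
    unfolding sum_distrib_left sum_divide_distrib
    by (intro sum.cong refl) (simp add: \<rho>i)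
  also have "\<dots> = (\<Sum>b<d. c * (v $ b * cnj (v $ b)) / of_real N)"
    by (intro sum.cong refl) (simp add: row)
  also have "\<dots> = c"
    using N by (simp add: sumN flip: sum_divide_distrib sum_distrib_left)
  finally show "mat_trace (\<rho> * A) = c" .
qed

section \<open>The minimum of beta over the simplex\<close>

text \<open>Bolzano-Weierstrass one coordinate at a time: refine to a monotone, hence convergent,
  subsequence for the new coordinate; the earlier limits survive. Weights are functions on the
  naturals, so the dimension n stays a variable.\<close>

lemma convergent_subseq_coordinates:
  fixes f :: "nat \<Rightarrow> nat \<Rightarrow> real"
  assumes "\<And>k i. i < n \<Longrightarrow> \<bar>f k i\<bar> \<le> K"
  shows "\<exists>r :: nat \<Rightarrow> nat. strict_mono r \<and> (\<forall>i<n. convergent (\<lambda>k. f (r k) i))"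
  using assms
proof (induction n)
  case 0
  show ?case by (intro exI[of _ id]) (auto simp: strict_mono_def)
next
  case (Suc n)
  then obtain r where r: "strict_mono r" "\<And>i. i < n \<Longrightarrow> convergent (\<lambda>k. f (r k) i)" by (meson less_Suc_eq)
  obtain s where s: "strict_mono s" "monoseq (\<lambda>k. f (r (s k)) n)"
    using seq_monosub[of "\<lambda>k. f (r k) n"] by blast
  have "Bseq (\<lambda>k. f (r (s k)) n)" using Suc.prems by (intro BseqI'[of _ K]) auto
  then have "convergent (\<lambda>k. f (r (s k)) n)" using s Bseq_monoseq_convergent by blast
  moreover have "convergent (\<lambda>k. f (r (s k)) i)" if "i < n" for i
    using convergent_subseq_convergent[OF r(2)[OF that] s(1)] by (simp add: o_def)
  ultimately have "\<forall>i<Suc n. convergent (\<lambda>k. f ((r \<circ> s) k) i)"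
    by (simp add: less_Suc_eq)
  then show ?case using strict_mono_o[OF r(1) s(1)] by blast
qed

text \<open>With this vector \<open>beta_S\<close> is a supremum of functions linear in the
  weights.\<close>

definition sq_expect :: "(nat \<Rightarrow> complex mat) \<Rightarrow> complex mat \<Rightarrow> nat \<Rightarrow> real" where
  "sq_expect S \<rho> i = (Re (mat_trace (\<rho> * S i)))^2"

lemma sq_expect_nonneg: "0 \<le> sq_expect S \<rho> i"
  by (simp add: sq_expect_def)

lemma beta_S_eq: "beta_S q n S w = Sup {(\<Sum>i<n. w i * sq_expect S \<rho> i) | \<rho>. density_matrix (2^q) \<rho>}"
  by (simp add: beta_S_def sq_expect_def)

section \<open>Bounds and minimisation of beta in a fixed realization\<close>

context
  fixes q n :: nat and S :: "nat \<Rightarrow> complex mat" and G :: "nat \<Rightarrow> nat \<Rightarrow> bool"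
  assumes real: "realization q n S G"
begin

lemma realization_pauli: "i < n \<Longrightarrow> \<exists>p. S i = pauli_string q p"
  using real unfolding realization_def is_pauli_string_def by blast

lemma realization_carrier: "i < n \<Longrightarrow> S i \<in> carrier_mat (2^q) (2^q)"
  using realization_pauli pauli_string_carrier by metis

lemma realization_hermitian:
  "i < n \<Longrightarrow> a < 2^q \<Longrightarrow> b < 2^q \<Longrightarrow> S i $$ (a,b) = cnj (S i $$ (b,a))"
  using realization_pauli pauli_string_hermitian by metis

lemma realization_square: "i < n \<Longrightarrow> S i * S i = 1\<^sub>m (2^q)"
  using realization_pauli pauli_string_square by metis

lemma realization_edge: "i < n \<Longrightarrow> j < n \<Longrightarrow> G i j \<Longrightarrow> S i * S j = - (S j * S i)"
  using real unfolding realization_def by blast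

lemma realization_non_edge:
  assumes "i < n" "j < n" "\<not> G i j"
  shows "S i * S j = S j * S i"
proof -
  obtain p p' where p: "S i = pauli_string q p" "S j = pauli_string q p'"
    using realization_pauli assms by blast
  have "S i * S j \<noteq> - (S j * S i)" using real assms unfolding realization_def by blast
  then show ?thesis using pauli_string_commute_or_anticommute[of q p p'] unfolding p by blast
qed

lemma moment_inequality:
  "density_matrix (2^q) \<rho> \<Longrightarrow>
   (\<Sum>i<n. u i * Re (mat_trace (\<rho> * S i)))^2 \<le> bil n (\<lambda>i j. Re (mat_trace (\<rho> * (S i * S j)))) u u"
  by (rule moment_matrix_inequality[OF _ realization_carrier realization_hermitian])

lemma trace_square:
  assumes "density_matrix (2^q) \<rho>" "i < n"
  shows "Re (mat_trace (\<rho> * (S i * S i))) = 1"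
proof -
  have "\<rho> \<in> carrier_mat (2^q) (2^q)" "mat_trace \<rho> = 1" using assms(1) unfolding density_matrix_def by blast+
  then show ?thesis using realization_square[OF assms(2)] by simp
qed

text \<open>The moment inequality at a unit vector, where the diagonal moment is 1 because S_i^2 =
  1. It makes the supremum in \<open>beta_S\<close> finite.\<close>

lemma sq_expect_le_1:
  assumes "density_matrix (2^q) \<rho>" "i < n"
  shows "sq_expect S \<rho> i \<le> 1"
proof -
  have "(\<Sum>k<n. of_bool (k = i) * Re (mat_trace (\<rho> * S k))) = (\<Sum>k<n. if k = i then Re (mat_trace (\<rho> * S k)) else 0)"
    by (intro sum.cong refl) simp
  then have "(\<Sum>k<n. of_bool (k = i) * Re (mat_trace (\<rho> * S k))) = Re (mat_trace (\<rho> * S i))"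
    using assms(2) by simp
  then show ?thesis
    using moment_inequality[OF assms(1), of "\<lambda>k. of_bool (k = i)"]
    by (simp add: bil_unit[OF assms(2,2)] trace_square[OF assms] sq_expect_def)
qed

lemma beta_S_upper:
  assumes "\<And>i. i < n \<Longrightarrow> 0 \<le> w i" "density_matrix (2^q) \<rho>"
  shows "(\<Sum>i<n. w i * sq_expect S \<rho> i) \<le> beta_S q n S w"
  unfolding beta_S_eq
proof (rule cSup_upper)
  show "bdd_above {(\<Sum>i<n. w i * sq_expect S \<rho> i) | \<rho>. density_matrix (2^q) \<rho>}"
  proof (rule bdd_aboveI)
    fix y assume "y \<in> {(\<Sum>i<n. w i * sq_expect S \<rho> i) | \<rho>. density_matrix (2^q) \<rho>}"
    then obtain \<rho> where "density_matrix (2^q) \<rho>" "y = (\<Sum>i<n. w i * sq_expect S \<rho> i)" by blast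
    then show "y \<le> (\<Sum>i<n. w i)"
      using sq_expect_le_1 assms(1) by (auto intro!: sum_mono mult_left_le)
  qed
qed (use assms in blast)

lemma independent_state:
  assumes "is_indep G n I"
  shows "\<exists>\<rho>. density_matrix (2^q) \<rho> \<and> (\<forall>i\<in>I. sq_expect S \<rho> i = 1)"
proof -
  have I: "I \<subseteq> {0..<n}" and nG: "\<And>i j. i \<in> I \<Longrightarrow> j \<in> I \<Longrightarrow> i \<noteq> j \<Longrightarrow> \<not> G i j"
    using assms unfolding is_indep_def by blast+
  have In: "i < n" if "i \<in> I" for i using I that by auto
  have "\<exists>v s. v \<in> carrier_vec (2^q) \<and> v \<noteq> 0\<^sub>v (2^q) \<and> (\<forall>i\<in>I. s i \<in> {1,-1} \<and> S i *\<^sub>v v = s i \<cdot>\<^sub>v v)"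
  proof (rule joint_eigenvector)
    show "finite I" using I finite_subset by blast
    show "S i * S j = S j * S i" if "i \<in> I" "j \<in> I" for i j
      using realization_non_edge[of i j] nG[of i j] In that by (cases "i = j") auto
  qed (use In realization_carrier realization_square in auto)
  then obtain v s where v: "v \<in> carrier_vec (2^q)" "v \<noteq> 0\<^sub>v (2^q)"
    and s: "\<And>i. i \<in> I \<Longrightarrow> s i \<in> {1,-1}" "\<And>i. i \<in> I \<Longrightarrow> S i *\<^sub>v v = s i \<cdot>\<^sub>v v" by blast
  define \<rho> where "\<rho> = mat (2^q) (2^q) (\<lambda>(a,b). v $ a * cnj (v $ b) / of_real (\<Sum>k<2^q. (cmod (v $ k))^2))"
  have "density_matrix (2^q) \<rho>" unfolding \<rho>_def by (rule pure_state(1)[OF v])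
  moreover have "sq_expect S \<rho> i = 1" if "i \<in> I" for i
  proof -
    have "mat_trace (\<rho> * S i) = s i"
      unfolding \<rho>_def by (rule pure_state(2)[OF v realization_carrier[OF In[OF that]] s(2)[OF that]])
    then show ?thesis using s(1)[OF that] by (auto simp: sq_expect_def)
  qed
  ultimately show ?thesis by blast
qed

lemma beta_S_least:
  assumes "\<And>\<rho>. density_matrix (2^q) \<rho> \<Longrightarrow> (\<Sum>i<n. w i * sq_expect S \<rho> i) \<le> c"
  shows "beta_S q n S w \<le> c"
proof -
  \<comment> \<open>The empty independent set supplies some density matrix, so the supremum is over
    a nonempty set.\<close>
  have "is_indep G n {}" by (simp add: is_indep_def)
  then have "{(\<Sum>i<n. w i * sq_expect S \<rho> i) | \<rho>. density_matrix (2^q) \<rho>} \<noteq> {}"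
    using independent_state by blast
  then show ?thesis unfolding beta_S_eq by (rule cSup_least) (use assms in blast)
qed

lemma beta_S_ge_independent:
  assumes "\<And>i. i < n \<Longrightarrow> 0 \<le> w i" "is_indep G n I"
  shows "(\<Sum>i\<in>I. w i) \<le> beta_S q n S w"
proof -
  obtain \<rho> where \<rho>: "density_matrix (2^q) \<rho>" "\<And>i. i \<in> I \<Longrightarrow> sq_expect S \<rho> i = 1"
    using independent_state assms(2) by blast
  have I: "I \<subseteq> {..<n}" using assms(2) unfolding is_indep_def by auto
  have "(\<Sum>i\<in>I. w i) = (\<Sum>i\<in>I. w i * sq_expect S \<rho> i)" by (intro sum.cong refl) (simp add: \<rho>)
  also have "\<dots> \<le> (\<Sum>i<n. w i * sq_expect S \<rho> i)"
    using I assms(1) by (intro sum_mono2) (auto simp: sq_expect_nonneg)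
  also have "\<dots> \<le> beta_S q n S w" by (rule beta_S_upper[OF assms(1) \<rho>(1)])
  finally show ?thesis .
qed

text \<open>A supremum of linear functions is lower semicontinuous: along a convergent minimising
  sequence the bound for each fixed state passes to the limit, and taking the supremum over states
  afterwards suffices.\<close>

lemma beta_S_attains_min:
  assumes "n \<ge> 1"
  shows "\<exists>w0\<in>simplex n. \<forall>w\<in>simplex n. beta_S q n S w0 \<le> beta_S q n S w"
proof -
  have nonneg: "0 \<le> beta_S q n S w" if "w \<in> simplex n" for w
    using beta_S_ge_independent[of w "{}"] that by (simp add: simplex_def is_indep_def)
  have "(\<lambda>i. of_bool (i = 0)) \<in> simplex n"
    using assms by (simp add: simplex_def sum.delta[of "{..<n}" 0 "\<lambda>_. 1 :: real"] of_bool_def)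
  then have ne: "beta_S q n S ` simplex n \<noteq> {}" by blast
  have bdd: "bdd_below (beta_S q n S ` simplex n)" using nonneg by (intro bdd_belowI[of _ 0]) auto
  define m where "m = Inf (beta_S q n S ` simplex n)"
  have "\<exists>w\<in>simplex n. beta_S q n S w < m + 1 / real (Suc k)" for k
    using cInf_lessD[OF ne, of "m + 1 / real (Suc k)"] unfolding m_def by auto
  then obtain W where W: "\<And>k. W k \<in> simplex n" "\<And>k. beta_S q n S (W k) < m + 1 / real (Suc k)"
    by metis
  have W0: "0 \<le> W k i" if "i < n" for k i using W(1)[of k] that by (simp add: simplex_def)
  have "\<bar>W k i\<bar> \<le> 1" if "i < n" for k i
  proof -
    have "W k i \<le> (\<Sum>i<n. W k i)" using that W0 by (intro member_le_sum) auto
    then show ?thesis using W(1)[of k] W0[OF that] by (simp add: simplex_def)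
  qed
  then obtain r where r: "strict_mono r" "\<And>i. i < n \<Longrightarrow> convergent (\<lambda>k. W (r k) i)"
    using convergent_subseq_coordinates[of n W 1] by blast
  define w0 where "w0 i = lim (\<lambda>k. W (r k) i)" for i
  have lim: "(\<lambda>k. W (r k) i) \<longlonglongrightarrow> w0 i" if "i < n" for i
    using r(2)[OF that] unfolding w0_def by (simp add: convergent_LIMSEQ_iff)
  have lims: "(\<lambda>k. \<Sum>i<n. W (r k) i * c i) \<longlonglongrightarrow> (\<Sum>i<n. w0 i * c i)" for c
    using lim by (intro tendsto_sum tendsto_mult tendsto_const) auto
  have w0: "w0 \<in> simplex n"
    unfolding simplex_def
  proof (intro CollectI conjI allI impI)
    show "0 \<le> w0 i" if "i < n" for i
      using lim[OF that] W0[OF that] by (intro LIMSEQ_le_const) auto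
    have "(\<lambda>k. \<Sum>i<n. W (r k) i * 1) \<longlonglongrightarrow> 1" using W(1) by (simp add: simplex_def)
    then show "(\<Sum>i<n. w0 i) = 1" using LIMSEQ_unique[OF lims[of "\<lambda>_. 1"]] by simp
  qed
  have "beta_S q n S w0 \<le> m"
  proof (rule beta_S_least)
    fix \<rho> assume \<rho>: "density_matrix (2^q) \<rho>"
    have "(\<lambda>k. m + 1 / real (Suc k)) \<longlonglongrightarrow> m + 0"
      by (intro tendsto_add tendsto_const LIMSEQ_Suc[OF lim_1_over_n])
    then have "(\<lambda>k. m + 1 / real (Suc (r k))) \<longlonglongrightarrow> m"
      using LIMSEQ_subseq_LIMSEQ[OF _ r(1), of "\<lambda>k. m + 1 / real (Suc k)" m] by (simp add: o_def)
    moreover have "(\<Sum>i<n. W (r k) i * sq_expect S \<rho> i) \<le> m + 1 / real (Suc (r k))" for k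
      using order.trans[OF beta_S_upper[OF W0 \<rho>] less_imp_le[OF W(2)]] .
    ultimately show "(\<Sum>i<n. w0 i * sq_expect S \<rho> i) \<le> m"
      using lims[of "sq_expect S \<rho>"] by (intro LIMSEQ_le) blast+
  qed
  moreover have "m \<le> beta_S q n S w" if "w \<in> simplex n" for w
    unfolding m_def using bdd that by (intro cInf_lower) auto
  ultimately show ?thesis using w0 order_trans by blast
qed

end

section \<open>Fractional packings\<close>

lemma is_clique_compl_graph: "is_clique (compl_graph G) n K \<longleftrightarrow> is_indep G n K"
  unfolding is_clique_def is_indep_def compl_graph_def by blast

definition packing_feasible :: "(nat \<Rightarrow> nat \<Rightarrow> bool) \<Rightarrow> nat \<Rightarrow> (nat \<Rightarrow> real) \<Rightarrow> bool" where
  "packing_feasible H n w \<longleftrightarrow> (\<forall>i<n. 0 \<le> w i) \<and> (\<forall>K. is_clique H n K \<longrightarrow> (\<Sum>i\<in>K. w i) \<le> 1)"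

lemma frac_packing_eq: "frac_packing H n = Sup {(\<Sum>i<n. w i) | w. packing_feasible H n w}"
  by (simp add: frac_packing_def packing_feasible_def)

text \<open>Singletons are cliques, so feasible weights are at most 1 and the supremum is
  finite.\<close>

lemma frac_packing_upper:
  assumes "packing_feasible H n w"
  shows "(\<Sum>i<n. w i) \<le> frac_packing H n"
  unfolding frac_packing_eq
proof (rule cSup_upper)
  have "(\<Sum>i<n. v i) \<le> n" if "packing_feasible H n v" for v
  proof -
    have "v i \<le> 1" if "i < n" for i
    proof -
      have "is_clique H n {i}" using that by (simp add: is_clique_def)
      then have "(\<Sum>j\<in>{i}. v j) \<le> 1" using \<open>packing_feasible H n v\<close> unfolding packing_feasible_def by blast
      then show ?thesis by simp
    qed
    then have "(\<Sum>i<n. v i) \<le> (\<Sum>i<n. 1)" by (intro sum_mono) simp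
    then show ?thesis by simp
  qed
  then show "bdd_above {(\<Sum>i<n. w i) | w. packing_feasible H n w}" by (intro bdd_aboveI[of _ "real n"]) blast
qed (use assms in blast)

lemma frac_packing_least:
  assumes "\<And>w. packing_feasible H n w \<Longrightarrow> (\<Sum>i<n. w i) \<le> c"
  shows "frac_packing H n \<le> c"
proof -
  have "packing_feasible H n (\<lambda>_. 0)" by (simp add: packing_feasible_def)
  then have "{(\<Sum>i<n. w i) | w. packing_feasible H n w} \<noteq> {}" by blast
  then show ?thesis unfolding frac_packing_eq by (rule cSup_least) (use assms in blast)
qed

text \<open>Some vertex carries positive weight and forms an independent set by itself. This permits
  division by beta.\<close>

lemma beta_S_pos:
  assumes "realization q n S G" "w \<in> simplex n"
  shows "0 < beta_S q n S w"
proof -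
  have w: "\<And>i. i < n \<Longrightarrow> 0 \<le> w i" "(\<Sum>i<n. w i) = 1" using assms(2) by (simp_all add: simplex_def)
  have "\<exists>i<n. w i \<noteq> 0"
  proof (rule ccontr)
    assume "\<not> (\<exists>i<n. w i \<noteq> 0)"
    then have "(\<Sum>i<n. w i) = 0" by (intro sum.neutral) simp
    then show False using w(2) by simp
  qed
  then obtain i where i: "i < n" "w i \<noteq> 0" by blast
  have "is_indep G n {i}" using i(1) by (simp add: is_indep_def)
  then have "w i \<le> beta_S q n S w" using beta_S_ge_independent[OF assms(1) w(1)] by fastforce
  then show ?thesis using w(1)[OF i(1)] i(2) by linarith
qed

lemma inverse_beta_S_le_frac_packing:
  assumes real: "realization q n S G" and w: "w \<in> simplex n"
  shows "1 / beta_S q n S w \<le> frac_packing (compl_graph G) n"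
proof -
  define m where "m = beta_S q n S w"
  have w': "\<And>i. i < n \<Longrightarrow> 0 \<le> w i" "(\<Sum>i<n. w i) = 1" using w by (simp_all add: simplex_def)
  have m: "m > 0" using beta_S_pos[OF assms] by (simp add: m_def)
  have "(\<Sum>i\<in>I. w i / m) \<le> 1" if "is_indep G n I" for I
  proof -
    have "(\<Sum>i\<in>I. w i) \<le> m" unfolding m_def by (rule beta_S_ge_independent[OF real w'(1) that])
    then show ?thesis using m by (simp flip: sum_divide_distrib)
  qed
  then have "packing_feasible (compl_graph G) n (\<lambda>i. w i / m)"
    using w'(1) m by (simp add: packing_feasible_def is_clique_compl_graph)
  from frac_packing_upper[OF this] show ?thesis
    by (simp add: w'(2) m_def flip: sum_divide_distrib)
qed

lemma frac_packing_le_inverse_min: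
  assumes real: "realization q n S G" and perfect: "hbar_perfect G n"
    and c: "c > 0" "\<And>w. w \<in> simplex n \<Longrightarrow> c \<le> beta_S q n S w"
  shows "frac_packing (compl_graph G) n \<le> 1 / c"
proof (rule frac_packing_least)
  fix v assume v: "packing_feasible (compl_graph G) n v"
  have v0: "\<And>i. i < n \<Longrightarrow> 0 \<le> v i" using v by (simp add: packing_feasible_def)
  define W where "W = (\<Sum>i<n. v i)"
  have "W \<ge> 0" unfolding W_def using v0 by (intro sum_nonneg) simp
  show "(\<Sum>i<n. v i) \<le> 1 / c"
  \<comment> \<open>A packing of total weight 0 cannot be normalised to a point of the
    simplex.\<close>
  proof (cases "W = 0")
    case True
    then show ?thesis using c(1) by (simp add: W_def)
  next
    case False
    with \<open>W \<ge> 0\<close> have W: "W > 0" by simp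
    let ?w = "\<lambda>i. v i / W"
    have "?w \<in> simplex n" using W v0 by (simp add: simplex_def W_def flip: sum_divide_distrib)
    then have "c \<le> beta_S q n S ?w" by (rule c(2))
    also have "\<dots> = alpha_w G n ?w"
      using perfect real v0 W unfolding hbar_perfect_def by simp
    also have "\<dots> \<le> 1 / W"
    proof -
      have "{I. is_indep G n I} \<subseteq> Pow {0..<n}" by (auto simp: is_indep_def)
      then have "finite {I. is_indep G n I}" by (rule finite_subset) simp
      moreover have "{} \<in> {I. is_indep G n I}" by (simp add: is_indep_def)
      moreover have "(\<Sum>i\<in>I. ?w i) \<le> 1 / W" if "is_indep G n I" for I
      proof -
        have "(\<Sum>i\<in>I. v i) \<le> 1" using v that by (simp add: packing_feasible_def is_clique_compl_graph)
        then show ?thesis using W by (simp add: divide_right_mono flip: sum_divide_distrib)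
      qed
      ultimately show ?thesis unfolding alpha_w_def by (subst Max_le_iff) auto
    qed
    finally show ?thesis using W c(1) by (simp add: W_def[symmetric] field_simps)
  qed
qed

section \<open>The theta number\<close>

definition theta_feasible :: "(nat \<Rightarrow> nat \<Rightarrow> bool) \<Rightarrow> nat \<Rightarrow> (nat \<Rightarrow> nat \<Rightarrow> real) \<Rightarrow> bool" where
  "theta_feasible H n F \<longleftrightarrow> psd_form n F \<and> (\<Sum>i<n. F i i) = 1 \<and>
     (\<forall>i<n. \<forall>j<n. i \<noteq> j \<longrightarrow> H i j \<longrightarrow> F i j = 0)"

lemma lovasz_theta_eq: "lovasz_theta H n = Sup {(\<Sum>i<n. \<Sum>j<n. F i j) | F. theta_feasible H n F}"
proof -
  have "(\<exists>B. s = (\<Sum>i<n. \<Sum>j<n. B $$ (i,j)) \<and>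
      psd_real n B \<and> mat_trace B = 1 \<and> (\<forall>i<n. \<forall>j<n. i \<noteq> j \<longrightarrow> H i j \<longrightarrow> B $$ (i,j) = 0)) \<longleftrightarrow>
    (\<exists>F. s = (\<Sum>i<n. \<Sum>j<n. F i j) \<and> theta_feasible H n F)" (is "(\<exists>B. ?P B) \<longleftrightarrow> (\<exists>F. ?Q F)") for s
  proof
    assume "\<exists>B. ?P B"
    then obtain B where B: "?P B" by blast
    then have "dim_row B = n" by (auto simp: psd_real_def)
    with B have "?Q (\<lambda>i j. B $$ (i,j))"
      unfolding theta_feasible_def psd_form_def psd_real_def bil_def mat_trace_def by simp
    then show "\<exists>F. ?Q F" by (intro exI[of _ "\<lambda>i j. B $$ (i,j)"])
  next
    assume "\<exists>F. ?Q F"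
    then obtain F where F: "?Q F" by blast
    then have sym: "\<forall>i<n. \<forall>j<n. F i j = F j i" and pos: "\<And>x. 0 \<le> (\<Sum>i<n. \<Sum>j<n. x i * F i j * x j)"
      unfolding theta_feasible_def psd_form_def bil_def by blast+
    define B where "B = mat n n (\<lambda>(i,j). F i j)"
    have Bi: "B $$ (i,j) = F i j" if "i < n" "j < n" for i j using that by (simp add: B_def)
    have "(\<Sum>i<n. \<Sum>j<n. x i * B $$ (i,j) * x j) = (\<Sum>i<n. \<Sum>j<n. x i * F i j * x j)" for x
      by (intro sum.cong refl) (simp add: Bi)
    then have "psd_real n B"
      using sym pos unfolding psd_real_def by (auto simp: Bi B_def)
    moreover have "(\<Sum>i<n. \<Sum>j<n. B $$ (i,j)) = (\<Sum>i<n. \<Sum>j<n. F i j)"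
      by (intro sum.cong refl) (simp add: Bi)
    moreover have "mat_trace B = (\<Sum>i<n. F i i)"
      unfolding mat_trace_def by (simp add: B_def)
    ultimately have "?P B" using F by (simp add: theta_feasible_def Bi)
    then show "\<exists>B. ?P B" by blast
  qed
  then show ?thesis unfolding lovasz_theta_def by simp
qed

lemma lovasz_theta_upper:
  assumes "theta_feasible H n F"
  shows "(\<Sum>i<n. \<Sum>j<n. F i j) \<le> lovasz_theta H n"
  unfolding lovasz_theta_eq
proof (rule cSup_upper)
  have "(\<Sum>i<n. \<Sum>j<n. F i j) \<le> real n" if "theta_feasible H n F" for F
    using psd_form_sum_le[of n F] that by (simp add: theta_feasible_def)
  then show "bdd_above {(\<Sum>i<n. \<Sum>j<n. F i j) | F. theta_feasible H n F}"
    by (intro bdd_aboveI[of _ "real n"]) blast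
qed (use assms in blast)

text \<open>A feasible point whose entries sum to 1: it makes the supremum nonempty and theta at
  least 1, hence safe to divide by.\<close>

lemma theta_feasible_identity:
  assumes "n \<ge> 1"
  shows "theta_feasible H n (\<lambda>i j. if i = j then 1 / real n else 0)"
proof -
  have "bil n (\<lambda>i j. if i = j then 1 / real n else 0) x x = (\<Sum>i<n. (x i)^2 / n)" for x
  proof -
    have "(\<Sum>j<n. x i * (if i = j then 1 / real n else 0) * x j) = (\<Sum>j<n. if i = j then (x j)^2 / n else 0)" for i
      by (intro sum.cong refl) (simp add: power2_eq_square)
    then show ?thesis unfolding bil_def by simp
  qed
  then show ?thesis
    using assms by (simp add: theta_feasible_def psd_form_def sum_nonneg)
qed

lemma lovasz_theta_ge_1:
  assumes "n \<ge> 1"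
  shows "1 \<le> lovasz_theta H n"
  using lovasz_theta_upper[OF theta_feasible_identity[OF assms]] assms by simp

text \<open>Rescaling B to diag(c) B diag(c) keeps the zero pattern, so the optimality of theta
  bounds all Rayleigh quotients of B relative to its diagonal.\<close>

lemma theta_feasible_Rayleigh:
  assumes "theta_feasible H n F"
  shows "bil n F c c \<le> lovasz_theta H n * (\<Sum>i<n. F i i * (c i)^2)"
proof -
  have F: "psd_form n F" and zero: "\<And>i j. i < n \<Longrightarrow> j < n \<Longrightarrow> i \<noteq> j \<Longrightarrow> H i j \<Longrightarrow> F i j = 0"
    using assms unfolding theta_feasible_def by blast+
  define N where "N = (\<Sum>i<n. F i i * (c i)^2)"
  define F1 where "F1 a = (\<lambda>i j. c i * F i j * c j * a)" for a :: real
  have bF1: "bil n (F1 a) x x = a * bil n F (\<lambda>i. c i * x i) (\<lambda>i. c i * x i)" for a x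
    unfolding bil_def F1_def sum_distrib_left by (intro sum.cong refl) (simp add: mult_ac)
  have psd: "psd_form n (F1 a)" if "a \<ge> 0" for a
    using F that unfolding psd_form_def bF1 by (auto simp: F1_def mult_ac)
  have tr: "(\<Sum>i<n. F1 a i i) = a * N" for a
    unfolding N_def F1_def sum_distrib_left by (intro sum.cong refl) (simp add: power2_eq_square mult_ac)
  have total: "(\<Sum>i<n. \<Sum>j<n. F1 a i j) = a * bil n F c c" for a
    unfolding bil_def F1_def sum_distrib_left by (intro sum.cong refl) (simp add: mult_ac)
  have "N \<ge> 0" unfolding N_def using psd_form_diag_nonneg[OF F] by (intro sum_nonneg) simp
  show ?thesis
  proof (cases "N = 0")
    \<comment> \<open>The rescaled kernel cannot be normalised to trace 1, but its zero trace forces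
      its entry sum to be at most 0.\<close>
    case True
    then show ?thesis
      using psd_form_sum_le[OF psd[of 1]] by (simp add: tr total N_def[symmetric])
  next
    case False
    with \<open>N \<ge> 0\<close> have N: "N > 0" by simp
    have "theta_feasible H n (F1 (1 / N))"
      unfolding theta_feasible_def using psd[of "1 / N"] N zero by (simp add: tr) (simp add: F1_def)
    from lovasz_theta_upper[OF this] show ?thesis
      using N by (simp add: total N_def[symmetric] field_simps)
  qed
qed

text \<open>The entrywise product of F with the real moment matrix is diag(F): F vanishes at
  distinct non-adjacent pairs, the moments vanish on edges, and the diagonal moments are 1.\<close>

lemma theta_feasible_moment_bound:
  assumes real: "realization q n S G" and F: "theta_feasible (compl_graph G) n F"
    and \<rho>: "density_matrix (2^q) \<rho>"
  shows "bil n F (sq_expect S \<rho>) (sq_expect S \<rho>) \<le> (\<Sum>i<n. F i i * sq_expect S \<rho> i)"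
proof -
  have psd: "psd_form n F" and zero: "\<And>i j. i < n \<Longrightarrow> j < n \<Longrightarrow> i \<noteq> j \<Longrightarrow> \<not> G i j \<Longrightarrow> F i j = 0"
    using F unfolding theta_feasible_def compl_graph_def by blast+
  define x where "x i = Re (mat_trace (\<rho> * S i))" for i
  define M where "M = (\<lambda>i j. Re (mat_trace (\<rho> * (S i * S j))))"
  have FM: "F i j * M i j = (if i = j then F i i else 0)" if "i < n" "j < n" for i j
  proof (cases "i = j")
    case True
    then show ?thesis using trace_square[OF real \<rho>] that by (simp add: M_def)
  next
    case False
    have "M i j = 0" if "G i j"
      unfolding M_def using realization_edge[OF real \<open>i < n\<close> \<open>j < n\<close> that] \<open>i < n\<close> \<open>j < n\<close>
      by (intro trace_anticommuting[OF \<rho>] realization_carrier[OF real] realization_hermitian[OF real])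
    then show ?thesis using zero[OF that False] False by auto
  qed
  \<comment> \<open>Each squared expectation is split into two factors, one moved into the kernel
    and one kept in the vector.\<close>
  have "bil n F (sq_expect S \<rho>) (sq_expect S \<rho>) = bil n (\<lambda>i j. F i j * (x i * x j * 1)) x x"
    unfolding bil_def by (intro sum.cong refl) (simp add: sq_expect_def x_def power2_eq_square)
  also have "\<dots> \<le> bil n (\<lambda>i j. F i j * M i j) x x"
  proof (rule psd_form_Hadamard_mono[OF psd])
    show "bil n (\<lambda>i j. x i * x j * 1) v v \<le> bil n M v v" for v
      using moment_inequality[OF real \<rho>, of v] unfolding bil_rank_one by (simp add: x_def M_def mult.commute)
  qed
  also have "\<dots> = (\<Sum>i<n. \<Sum>j<n. if i = j then F i i * sq_expect S \<rho> i else 0)"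
    unfolding bil_def by (intro sum.cong refl) (simp add: FM sq_expect_def x_def power2_eq_square)
  finally show ?thesis by simp
qed

text \<open>Working with the defect theta - t of a near-optimal B, instead of complementary slackness at
  an optimal one, makes it unnecessary that the optimum is attained.\<close>

lemma beta_S_diag_le:
  assumes n: "n \<ge> 1" and real: "realization q n S G" and F: "theta_feasible (compl_graph G) n F"
  defines "\<theta> \<equiv> lovasz_theta (compl_graph G) n"
  defines "t \<equiv> (\<Sum>i<n. \<Sum>j<n. F i j)"
  shows "\<theta> * beta_S q n S (\<lambda>i. F i i) \<le> 1 + 2 * sqrt ((\<theta> - t) * \<theta>)"
proof -
  have psd: "psd_form n F" and tr: "(\<Sum>i<n. F i i) = 1"
    using F unfolding theta_feasible_def by blast+
  have \<theta>: "\<theta> > 0" using lovasz_theta_ge_1[OF n, of "compl_graph G"] by (simp add: \<theta>_def)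
  have t: "t \<le> \<theta>" unfolding t_def \<theta>_def by (rule lovasz_theta_upper[OF F])
  define \<eta> where "\<eta> = sqrt ((\<theta> - t) * \<theta>)"
  have \<eta>: "\<eta> \<ge> 0" "\<eta>^2 = (\<theta> - t) * \<theta>" using t \<theta> by (simp_all add: \<eta>_def)
  define D where "D = (\<lambda>i j. if i = j then \<theta> * F i i else 0)"
  \<comment> \<open>Q is \<theta> diag(F) - F, positive semidefinite by the Rayleigh bound. Its
    value at the all-ones vector is the defect \<theta> - t.\<close>
  define Q where "Q = (\<lambda>i j. D i j - F i j)"
  have D: "bil n D x y = \<theta> * (\<Sum>i<n. F i i * (x i * y i))" for x y
  proof -
    have "bil n D x y = (\<Sum>i<n. \<Sum>j<n. if i = j then \<theta> * (F i i * (x i * y i)) else 0)"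
      unfolding bil_def D_def by (intro sum.cong refl) (simp add: mult_ac)
    then show ?thesis by (simp add: sum_distrib_left)
  qed
  have Qbil: "bil n Q x y = \<theta> * (\<Sum>i<n. F i i * (x i * y i)) - bil n F x y" for x y
    unfolding Q_def bil_minus D ..
  have Q: "psd_form n Q"
    unfolding psd_form_def
  proof (intro conjI allI impI)
    show "Q i j = Q j i" if "i < n" "j < n" for i j
      using psd that unfolding psd_form_def Q_def D_def by simp
    show "0 \<le> bil n Q x x" for x
      using theta_feasible_Rayleigh[OF F, of x] unfolding Qbil \<theta>_def by (simp add: power2_eq_square)
  qed
  have ones: "bil n F (\<lambda>_. 1) (\<lambda>_. 1) = t" by (simp add: bil_def t_def)
  have "(\<Sum>i<n. F i i * sq_expect S \<rho> i) \<le> (1 + 2 * \<eta>) / \<theta>" if \<rho>: "density_matrix (2^q) \<rho>" for \<rho>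
  proof -
    define z where "z = sq_expect S \<rho>"
    define s where "s = (\<Sum>i<n. F i i * z i)"
    have z: "0 \<le> z i" "i < n \<Longrightarrow> z i \<le> 1" for i
      using sq_expect_nonneg sq_expect_le_1[OF real \<rho>] by (simp_all add: z_def)
    have s0: "0 \<le> s" unfolding s_def using psd_form_diag_nonneg[OF psd] z by (intro sum_nonneg) simp
    have zFz: "bil n F z z \<le> s" unfolding s_def z_def by (rule theta_feasible_moment_bound[OF real F \<rho>])
    define p where "p = bil n F (\<lambda>_. 1) z"
    define r where "r = bil n Q (\<lambda>_. 1) z"
    \<comment> \<open>Since \<open>D\<close> = F + Q, the main term p is controlled by
      Cauchy-Schwarz for F and the error r by Cauchy-Schwarz for Q.\<close>
    have split: "\<theta> * s = p + r" unfolding p_def r_def Qbil s_def by simp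
    have Fzz: "0 \<le> bil n F z z" using psd unfolding psd_form_def by blast
    have "p^2 \<le> t * bil n F z z" using psd_form_Cauchy_Schwarz[OF psd, of "\<lambda>_. 1" z] by (simp add: p_def ones)
    also have "\<dots> \<le> \<theta> * s" using t \<theta> zFz Fzz by (intro mult_mono) simp_all
    finally have p: "p^2 \<le> \<theta> * s" .
    have "bil n Q (\<lambda>_. 1) (\<lambda>_. 1) = \<theta> - t" unfolding Qbil ones by (simp add: tr)
    then have "r^2 \<le> (\<theta> - t) * bil n Q z z"
      using psd_form_Cauchy_Schwarz[OF Q, of "\<lambda>_. 1" z] by (simp add: r_def)
    also have "bil n Q z z \<le> \<theta>"
    proof -
      have "(\<Sum>i<n. F i i * (z i * z i)) \<le> (\<Sum>i<n. F i i)"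
        using z psd_form_diag_nonneg[OF psd] by (intro sum_mono) (simp add: mult_left_le mult_le_one)
      then show ?thesis unfolding Qbil using \<theta> Fzz tr by (simp add: mult_left_le diff_le_eq add_increasing2)
    qed
    finally have "r^2 \<le> \<eta>^2" using t by (simp add: \<eta>(2) mult_left_mono)
    then have r: "r \<le> \<eta>" using \<eta>(1) by (rule power2_le_imp_le)
    \<comment> \<open>From p^2 \<le> p + r \<le> p + \<eta>, the case p > 1 + \<eta> is impossible:
      p (p - 1) would exceed (1 + \<eta>) \<eta>, which is at least \<eta>.\<close>
    have "\<theta> * s \<le> 1 + 2 * \<eta>"
    proof (cases "p \<le> 1 + \<eta>")
      case True
      then show ?thesis using split r by linarith
    next
      case False
      have "p * p \<le> p + \<eta>" using p split r by (simp add: power2_eq_square)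
      moreover have "(1 + \<eta>) * (p - 1) \<le> p * (p - 1)" using False \<eta>(1) by (intro mult_right_mono) simp_all
      moreover have "0 \<le> \<eta> * (p - 1)" using False \<eta>(1) by (intro mult_nonneg_nonneg) simp_all
      ultimately have "p - 1 \<le> \<eta>" by (simp add: algebra_simps)
      then show ?thesis using False by simp
    qed
    then have "s \<le> (1 + 2 * \<eta>) / \<theta>" using \<theta> by (simp add: field_simps)
    then show ?thesis unfolding s_def z_def .
  qed
  then have "beta_S q n S (\<lambda>i. F i i) \<le> (1 + 2 * \<eta>) / \<theta>" by (rule beta_S_least[OF real])
  then show ?thesis using \<theta> by (simp add: \<eta>_def field_simps)
qed

text \<open>The diagonal of a feasible kernel is itself a point of the simplex, so its beta bounds c
  from above; the error disappears as the entry sum approaches theta.\<close>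

lemma min_beta_le_inverse_theta:
  assumes n: "n \<ge> 1" and real: "realization q n S G"
    and c: "\<And>w. w \<in> simplex n \<Longrightarrow> c \<le> beta_S q n S w"
  shows "c \<le> 1 / lovasz_theta (compl_graph G) n"
proof (rule ccontr)
  assume contr: "\<not> ?thesis"
  define \<theta> where "\<theta> = lovasz_theta (compl_graph G) n"
  have \<theta>: "\<theta> > 0" using lovasz_theta_ge_1[OF n, of "compl_graph G"] by (simp add: \<theta>_def)
  define \<delta> where "\<delta> = \<theta> * c - 1"
  have \<delta>: "\<delta> > 0" using contr \<theta> by (simp add: \<delta>_def \<theta>_def[symmetric] field_simps)
  \<comment> \<open>With defect below e the error is at most 2 sqrt(e \<theta>) = \<delta> / sqrt 2,
    strictly less than the excess \<delta>. Any constant above 4 in place of 8 has this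
    effect.\<close>
  define e where "e = \<delta>^2 / (8 * \<theta>)"
  have e: "e > 0" using \<delta> \<theta> by (simp add: e_def)
  let ?T = "{(\<Sum>i<n. \<Sum>j<n. F i j) | F. theta_feasible (compl_graph G) n F}"
  have ne: "?T \<noteq> {}" using theta_feasible_identity[OF n] by blast
  have lt: "\<theta> - e < Sup ?T" using e unfolding \<theta>_def lovasz_theta_eq by simp
  obtain y where "y \<in> ?T" "\<theta> - e < y" by (rule less_cSupE[OF lt ne])
  then obtain F where F: "theta_feasible (compl_graph G) n F" and t: "\<theta> - e < (\<Sum>i<n. \<Sum>j<n. F i j)"
    by auto
  define t' where "t' = (\<Sum>i<n. \<Sum>j<n. F i j)"
  have t': "\<theta> - t' < e" "0 \<le> \<theta> - t'"
    using t lovasz_theta_upper[OF F] by (simp_all add: t'_def \<theta>_def)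
  have "(\<lambda>i. F i i) \<in> simplex n"
    using F psd_form_diag_nonneg unfolding theta_feasible_def simplex_def by blast
  then have "\<theta> * c \<le> \<theta> * beta_S q n S (\<lambda>i. F i i)" using c \<theta> by simp
  also have "\<dots> \<le> 1 + 2 * sqrt ((\<theta> - t') * \<theta>)"
    unfolding \<theta>_def t'_def by (rule beta_S_diag_le[OF n real F])
  finally have "\<delta> / 2 \<le> sqrt ((\<theta> - t') * \<theta>)" by (simp add: \<delta>_def)
  also have "\<dots> \<le> sqrt (e * \<theta>)" using t' \<theta> by simp
  finally have "(\<delta> / 2)^2 \<le> (sqrt (e * \<theta>))^2" using \<delta> by (intro power_mono) simp_all
  then have "(\<delta> / 2)^2 \<le> e * \<theta>" using e \<theta> by simp
  then show False using \<delta> \<theta> by (simp add: e_def power2_eq_square field_simps)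
qed

theorem theorem5:
  fixes G :: "nat \<Rightarrow> nat \<Rightarrow> bool" and n q :: nat and S :: "nat \<Rightarrow> complex mat"
  assumes "n \<ge> 1"
    and "realization q n S G"
  shows "\<exists>w0\<in>simplex n.
           (\<forall>w\<in>simplex n. beta_S q n S w0 \<le> beta_S q n S w) \<and>
           1 / frac_packing (compl_graph G) n \<le> beta_S q n S w0 \<and>
           beta_S q n S w0 \<le> 1 / lovasz_theta (compl_graph G) n \<and>
           (hbar_perfect G n \<longrightarrow> beta_S q n S w0 = 1 / frac_packing (compl_graph G) n)"
proof -
  obtain w0 where w0: "w0 \<in> simplex n" and min: "\<And>w. w \<in> simplex n \<Longrightarrow> beta_S q n S w0 \<le> beta_S q n S w"
    using beta_S_attains_min[OF assms(2,1)] by blast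
  have pos: "0 < beta_S q n S w0" by (rule beta_S_pos[OF assms(2) w0])
  have packing: "1 / beta_S q n S w0 \<le> frac_packing (compl_graph G) n"
    by (rule inverse_beta_S_le_frac_packing[OF assms(2) w0])
  have packing_pos: "0 < frac_packing (compl_graph G) n"
    by (rule less_le_trans[OF _ packing]) (simp add: pos)
  have lower: "1 / frac_packing (compl_graph G) n \<le> beta_S q n S w0"
    using packing pos packing_pos by (simp add: field_simps)
  \<comment> \<open>The minimum itself serves as the positive lower bound c.\<close>
  have "beta_S q n S w0 \<le> 1 / frac_packing (compl_graph G) n" if "hbar_perfect G n"
    using frac_packing_le_inverse_min[OF assms(2) that pos min] pos packing_pos by (simp add: field_simps)
  with w0 min lower min_beta_le_inverse_theta[OF assms min] show ?thesis
    by (intro bexI[of _ w0]) (auto intro: antisym)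
qed

end
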